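(* Let $u_n=\mu(A_1\cap T^{-n}A_1)$ and $S(z)=\sum_{n\ge0}z^nu_n$. Then $S(z)$ is holomorphic in $\{|z|<1\}$ and extends continuously to $\{|z|\le1\}\setminus\{1\}$. Moreover, for $z$ in some neighbourhood of $z=1$, with $z\ne1$, it can be written as $$S(z)=\nu(\mathcal P_zh)\cdot Q(z)+\nu\big((1-\mathcal N_z)^{-1}h\big),$$ where $\mathcal P_z=h_z\cdot\nu_z$ is the spectral projection of $\mathcal M_z$ corresponding to the eigenvalue $\lambda_z$, and $Q(z)=(1-\lambda_z)^{-1}$.
   Context: Shift and potential. $\Omega=\{0,1\}^{\{0,1,2,\dots\}}$, $T$ is the left shift, $0^\infty=(000\dots)$, $\tau(\omega)=1+\inf\{i\ge 0:\omega_i=1\}$ (with $\inf\emptyset=\infty$), $A_k=\{\omega:\tau(\omega)=k\}$ for $k\ge1$. Let $\Omega_*$ be the set of $\omega\in\Omega$ with infinitely many $1$'s. For $\omega\in\Omega_*$ the times between passages are $\sigma_k(\omega)=\tau\big((T^\tau)^k\omega\big)$, $k\ge 0$, where $T^\tau\omega=T^{\tau(\omega)}\omega$. A potential $V:\Omega\to\mathbb R$ is given, with induced version $W(\omega)=\sum_{k=0}^{\tau(\omega)-1}V(T^k\omega)$, satisfying: (1) $V$ is continuous, $-C_1\le V\le 0$ for some constant $C_1>0$, and $V(0^\infty)=0$; (2) $\sum_{n\ge1}\exp(\sup_{A_n}W)<C_2$ for some constant $C_2>0$; (3) for some $0<\theta<1$ and $C_3>0$, for all $n\ge1$, $\mathrm{Var}_nW\le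 C_3\theta^n$, where $\mathrm{Var}_nW=\sup\{|W(\omega)-W(\omega')|:\inf\{k\ge0:\sigma_k(\omega)\ne\sigma_k(\omega')\}=n\}$; (4) the limit $\lim_n\frac1n\log\sum_{\omega_0,\dots,\omega_{n-1}}\exp\big(\sup_{\omega'\in\Omega}\sum_{i=0}^{n-1}V(\omega_i\dots\omega_{n-1}\omega')\big)$ exists and equals $0$. Induced operator and measures. Put $\varphi=e^V$, $\psi=e^W$. $\mathcal F_\theta$ is the Banach space of bounded complex functions on $\Omega_*$ which are Lipschitz for $d_\theta(\omega,\omega')=\theta^{\inf\{j\ge0:\sigma_j(\omega)\neq\sigma_j(\omega')\}}$, normed by sup norm plus least Lipschitz constant. For $|z|\le1$, $(\mathcal M_zf)(\omega)=\sum_{n\ge1}z^n\psi(0^{n-1}1\omega)f(0^{n-1}1\omega)$, a bounded operator on $\mathcal F_\theta$. For $z\in(0,1]$ its spectral radius $\lambda_z$ is a simple eigenvalue, and $\lambda_z>0$, $h_z\in\mathcal F_\theta$, $\nu_z\in\mathcal F_\theta^*$ are uniquely determined by $\mathcal M_zh_z=\lambda_zh_z$, $\mathcal M_z^*\nu_z=\lambda_z\nu_z$, $h_z>0$, $\nu_z(h_z)=1$ ($\nu_z$ being a normalized measure). One has $\lambda_1=1$; write $\mathcal M=\mathcal M_1$, $h=h_1$, $\nu=\nu_1$. With $(\mathcal L_0f)(\omega)=\varphi(0\omega)f(0\omega)$, put $e=\sum_{k\ge0}\mathcal L_0^kh$ and $\mu=e\cdot\nu$, a $\sigma$-finite $T$-invariant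 measure with $\mu(A_1)=1$ (extended to $\Omega$ by giving mass $0$ to $\Omega\setminus\Omega_*$). Spectral data near $z=1$. The functions $\lambda_z,h_z,\nu_z$ extend holomorphically to a neighbourhood $J$ of $[0,1)$, with $\lambda_z\neq0$, $\mathcal M_zh_z=\lambda_zh_z$, $\mathcal M_z^*\nu_z=\lambda_z\nu_z$, $\nu_z(h_z)=1$ for $z\in J\cup\{1\}$. For such $z$, $\mathcal P_zf=\nu_z(f)h_z$, and $\mathcal N_z$ is defined by $\mathcal M_zf=\lambda_z\,\nu_z(f)\,h_z+\mathcal N_zf$. For $z$ near $1$ the spectral radius of $\mathcal N_z$ is smaller than $1$, and $(1-\mathcal N_z)^{-1}$ is the inverse of the bounded operator $1-\mathcal N_z$ on $\mathcal F_\theta$.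
   Formalization: The displayed formula is off by ν(P_z h) when (1−N_z)^{-1} is the inverse on all of F_θ; the formal formula for S(z) subtracts ν(P_z h). Also λ_z≠0 is assumed only for z≠0, because M_0=0 forces λ_0=0. *)

theory Defs
  imports "HOL-Probability.Probability"
begin

section \<open>The full shift and the times between passages\<close>

text \<open>Points of \<open>{0,1}\<^sup>\<nat>\<close>; \<open>True\<close> is the symbol 1. The type carries the product topology
  of the discrete space \<^typ>\<open>bool\<close>, and \<^term>\<open>borel\<close> is the corresponding Borel structure.\<close>

type_synonym omega = "nat \<Rightarrow> bool"

definition shift :: "omega \<Rightarrow> omega" where
  "shift \<omega> = (\<lambda>i. \<omega> (Suc i))"

definition prepend :: "bool list \<Rightarrow> omega \<Rightarrow> omega" where
  "prepend w \<omega> = (\<lambda>i. if i < length w then w ! i else \<omega> (i - length w))"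

text \<open>The word \<open>0\<^sup>n 1\<close> put in front of a point. Its passage time is \<open>n + 1\<close>, so sums over
  passage times starting at 1 become sums over all \<open>n\<close> starting at 0.\<close>

definition pre :: "nat \<Rightarrow> omega \<Rightarrow> omega" where
  "pre n \<omega> = prepend (replicate n False @ [True]) \<omega>"

definition tau :: "omega \<Rightarrow> enat" where
  "tau \<omega> = 1 + Inf {enat i |i. \<omega> i}"

definition level :: "nat \<Rightarrow> omega set" where
  "level k = {\<omega>. tau \<omega> = enat k}"

definition Omega_star :: "omega set" where
  "Omega_star = {\<omega>. infinite {i. \<omega> i}}"

text \<open>\<open>induced_shift\<close> and \<open>sigma\<close> are meaningful on \<open>Omega_star\<close> only; they are never used elsewhere.\<close>

definition induced_shift :: "omega \<Rightarrow> omega" where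
  "induced_shift \<omega> = (shift ^^ the_enat (tau \<omega>)) \<omega>"

definition sigma :: "nat \<Rightarrow> omega \<Rightarrow> enat" where
  "sigma k \<omega> = tau ((induced_shift ^^ k) \<omega>)"

definition sep :: "omega \<Rightarrow> omega \<Rightarrow> enat" where
  "sep \<omega> \<omega>' = Inf {enat k |k. sigma k \<omega> \<noteq> sigma k \<omega>'}"

definition dtheta :: "real \<Rightarrow> omega \<Rightarrow> omega \<Rightarrow> real" where
  "dtheta \<theta> \<omega> \<omega>' = (case sep \<omega> \<omega>' of enat n \<Rightarrow> \<theta> ^ n | \<infinity> \<Rightarrow> 0)"

section \<open>The potential\<close>

text \<open>Meaningful where \<open>tau \<omega>\<close> is finite.\<close>

definition Wpot :: "(omega \<Rightarrow> real) \<Rightarrow> omega \<Rightarrow> real" where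
  "Wpot V \<omega> = (\<Sum>k<the_enat (tau \<omega>). V ((shift ^^ k) \<omega>))"

definition phi :: "(omega \<Rightarrow> real) \<Rightarrow> omega \<Rightarrow> real" where
  "phi V \<omega> = exp (V \<omega>)"

definition psi :: "(omega \<Rightarrow> real) \<Rightarrow> omega \<Rightarrow> real" where
  "psi V \<omega> = exp (Wpot V \<omega>)"

definition Var :: "nat \<Rightarrow> (omega \<Rightarrow> real) \<Rightarrow> ereal" where
  "Var n g = Sup {ereal \<bar>g \<omega> - g \<omega>'\<bar> |\<omega> \<omega>'.
                    \<omega> \<in> Omega_star \<and> \<omega>' \<in> Omega_star \<and> sep \<omega> \<omega>' = enat n}"

definition partition_sum :: "(omega \<Rightarrow> real) \<Rightarrow> nat \<Rightarrow> real" where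
  "partition_sum V n =
     (\<Sum>w\<in>{w :: bool list. length w = n}.
        exp (SUP \<omega>'. \<Sum>i<n. V (prepend (drop i w) \<omega>')))"

definition admissible_potential ::
    "(omega \<Rightarrow> real) \<Rightarrow> real \<Rightarrow> real \<Rightarrow> real \<Rightarrow> real \<Rightarrow> bool" where
  "admissible_potential V C1 C2 C3 \<theta> \<longleftrightarrow>
     C1 > 0 \<and> C2 > 0 \<and> C3 > 0 \<and> 0 < \<theta> \<and> \<theta> < 1 \<and>
     continuous_on UNIV V \<and> (\<forall>\<omega>. - C1 \<le> V \<omega> \<and> V \<omega> \<le> 0) \<and> V (\<lambda>_. False) = 0 \<and>
     summable (\<lambda>n. exp (SUP \<omega>\<in>level (Suc n). Wpot V \<omega>)) \<and>
     (\<Sum>n. exp (SUP \<omega>\<in>level (Suc n). Wpot V \<omega>)) < C2 \<and>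
     (\<forall>n\<ge>1. Var n (Wpot V) \<le> ereal (C3 * \<theta> ^ n)) \<and>
     (\<lambda>n. 1 / real n * ln (partition_sum V n)) \<longlonglongrightarrow> 0"

section \<open>The Banach space and its operators\<close>

text \<open>Functions on \<open>Omega_star\<close> are represented by total functions that vanish off \<open>Omega_star\<close>,
  so that equality of functions is equality on \<open>Omega_star\<close>.\<close>

definition is_Lip :: "real \<Rightarrow> (omega \<Rightarrow> complex) \<Rightarrow> real \<Rightarrow> bool" where
  "is_Lip \<theta> f L \<longleftrightarrow> 0 \<le> L \<and>
     (\<forall>\<omega>\<in>Omega_star. \<forall>\<omega>'\<in>Omega_star. cmod (f \<omega> - f \<omega>') \<le> L * dtheta \<theta> \<omega> \<omega>')"

definition Fspace :: "real \<Rightarrow> (omega \<Rightarrow> complex) set" where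
  "Fspace \<theta> = {f. (\<forall>\<omega>. \<omega> \<notin> Omega_star \<longrightarrow> f \<omega> = 0) \<and> bounded (f ` Omega_star) \<and> (\<exists>L. is_Lip \<theta> f L)}"

definition Fnorm :: "real \<Rightarrow> (omega \<Rightarrow> complex) \<Rightarrow> real" where
  "Fnorm \<theta> f = (SUP \<omega>\<in>Omega_star. cmod (f \<omega>)) + Inf {L. is_Lip \<theta> f L}"

definition Fdual :: "real \<Rightarrow> ((omega \<Rightarrow> complex) \<Rightarrow> complex) set" where
  "Fdual \<theta> = {\<nu>.
     (\<forall>f\<in>Fspace \<theta>. \<forall>g\<in>Fspace \<theta>. \<nu> (\<lambda>\<omega>. f \<omega> + g \<omega>) = \<nu> f + \<nu> g) \<and>
     (\<forall>c. \<forall>f\<in>Fspace \<theta>. \<nu> (\<lambda>\<omega>. c * f \<omega>) = c * \<nu> f) \<and>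
     (\<exists>C. \<forall>f\<in>Fspace \<theta>. cmod (\<nu> f) \<le> C * Fnorm \<theta> f)}"

definition Fdual_norm :: "real \<Rightarrow> ((omega \<Rightarrow> complex) \<Rightarrow> complex) \<Rightarrow> real" where
  "Fdual_norm \<theta> \<nu> = (SUP f\<in>{f\<in>Fspace \<theta>. Fnorm \<theta> f \<le> 1}. cmod (\<nu> f))"

definition bounded_op :: "real \<Rightarrow> ((omega \<Rightarrow> complex) \<Rightarrow> omega \<Rightarrow> complex) \<Rightarrow> bool" where
  "bounded_op \<theta> A \<longleftrightarrow> A ` Fspace \<theta> \<subseteq> Fspace \<theta> \<and>
     (\<forall>f\<in>Fspace \<theta>. \<forall>g\<in>Fspace \<theta>. A (\<lambda>\<omega>. f \<omega> + g \<omega>) = (\<lambda>\<omega>. A f \<omega> + A g \<omega>)) \<and>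
     (\<forall>c. \<forall>f\<in>Fspace \<theta>. A (\<lambda>\<omega>. c * f \<omega>) = (\<lambda>\<omega>. c * A f \<omega>)) \<and>
     (\<exists>C. \<forall>f\<in>Fspace \<theta>. Fnorm \<theta> (A f) \<le> C * Fnorm \<theta> f)"

definition spectrum_op :: "real \<Rightarrow> ((omega \<Rightarrow> complex) \<Rightarrow> omega \<Rightarrow> complex) \<Rightarrow> complex set" where
  "spectrum_op \<theta> A = {\<zeta>. \<not> (\<exists>R. bounded_op \<theta> R \<and>
     (\<forall>f\<in>Fspace \<theta>. R (\<lambda>\<omega>. \<zeta> * f \<omega> - A f \<omega>) = f \<and> (\<lambda>\<omega>. \<zeta> * R f \<omega> - A (R f) \<omega>) = f))}"

definition spectral_radius_op :: "real \<Rightarrow> ((omega \<Rightarrow> complex) \<Rightarrow> omega \<Rightarrow> complex) \<Rightarrow> real" where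
  "spectral_radius_op \<theta> A = (SUP \<zeta>\<in>spectrum_op \<theta> A. cmod \<zeta>)"

text \<open>Algebraic simplicity: the generalized eigenspace is one-dimensional.\<close>

definition simple_eigenvalue ::
    "real \<Rightarrow> ((omega \<Rightarrow> complex) \<Rightarrow> omega \<Rightarrow> complex) \<Rightarrow> complex \<Rightarrow> bool" where
  "simple_eigenvalue \<theta> A \<zeta> \<longleftrightarrow>
     (\<exists>g\<in>Fspace \<theta>. g \<noteq> (\<lambda>_. 0) \<and>
        {f\<in>Fspace \<theta>. \<exists>n. ((\<lambda>u \<omega>. A u \<omega> - \<zeta> * u \<omega>) ^^ n) f = (\<lambda>_. 0)} = {\<lambda>\<omega>. c * g \<omega> |c. True})"

text \<open>Holomorphy of a family of complex-valued functions, as a map into a normed space with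
  carrier \<open>X\<close> and norm \<open>nrm\<close>.\<close>

definition holomorphic_family ::
    "('a \<Rightarrow> complex) set \<Rightarrow> (('a \<Rightarrow> complex) \<Rightarrow> real) \<Rightarrow> complex set \<Rightarrow> (complex \<Rightarrow> 'a \<Rightarrow> complex) \<Rightarrow> bool"
  where
  "holomorphic_family X nrm U F \<longleftrightarrow> (\<forall>z\<in>U. F z \<in> X) \<and>
     (\<forall>z\<in>U. \<exists>D\<in>X. ((\<lambda>w. nrm (\<lambda>x. (F w x - F z x) / (w - z) - D x)) \<longlongrightarrow> 0) (at z))"

definition transfer_op ::
    "(omega \<Rightarrow> real) \<Rightarrow> complex \<Rightarrow> (omega \<Rightarrow> complex) \<Rightarrow> omega \<Rightarrow> complex" where
  "transfer_op V z f \<omega> =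
     (if \<omega> \<in> Omega_star
      then (\<Sum>n. z ^ Suc n * complex_of_real (psi V (pre n \<omega>)) * f (pre n \<omega>)) else 0)"

definition L0_op :: "(omega \<Rightarrow> real) \<Rightarrow> (omega \<Rightarrow> complex) \<Rightarrow> omega \<Rightarrow> complex" where
  "L0_op V f \<omega> = complex_of_real (phi V (prepend [False] \<omega>)) * f (prepend [False] \<omega>)"

definition proj_op ::
    "((omega \<Rightarrow> complex) \<Rightarrow> complex) \<Rightarrow> (omega \<Rightarrow> complex) \<Rightarrow> (omega \<Rightarrow> complex) \<Rightarrow> omega \<Rightarrow> complex" where
  "proj_op nz hz f = (\<lambda>\<omega>. nz f * hz \<omega>)"

definition N_op ::
    "(omega \<Rightarrow> real) \<Rightarrow> complex \<Rightarrow> complex \<Rightarrow> (omega \<Rightarrow> complex) \<Rightarrow> ((omega \<Rightarrow> complex) \<Rightarrow> complex) \<Rightarrow>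
     (omega \<Rightarrow> complex) \<Rightarrow> omega \<Rightarrow> complex" where
  "N_op V z lz hz nz f = (\<lambda>\<omega>. transfer_op V z f \<omega> - lz * nz f * hz \<omega>)"

text \<open>\<open>(1 - A)\<^sup>-\<^sup>1\<close> on the whole Banach space. For \<open>A = N\<^sub>z\<close> it therefore fixes the range of the
  projection \<open>P\<^sub>z\<close>, and \<open>(1 - M\<^sub>z)\<^sup>-\<^sup>1 = (1 - \<lambda>\<^sub>z)\<^sup>-\<^sup>1 P\<^sub>z + (1 - N\<^sub>z)\<^sup>-\<^sup>1 - P\<^sub>z\<close>: the last term
  is there because \<open>M\<^sub>z\<^sup>k = \<lambda>\<^sub>z\<^sup>k P\<^sub>z + N\<^sub>z\<^sup>k\<close> holds for \<open>k \<ge> 1\<close> but not for \<open>k = 0\<close>.\<close>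

definition inv_one_minus ::
    "real \<Rightarrow> ((omega \<Rightarrow> complex) \<Rightarrow> omega \<Rightarrow> complex) \<Rightarrow> (omega \<Rightarrow> complex) \<Rightarrow> omega \<Rightarrow> complex" where
  "inv_one_minus \<theta> A = inv_into (Fspace \<theta>) (\<lambda>f \<omega>. f \<omega> - A f \<omega>)"

section \<open>Spectral data\<close>

definition given_by_measure :: "real \<Rightarrow> ((omega \<Rightarrow> complex) \<Rightarrow> complex) \<Rightarrow> omega measure \<Rightarrow> bool" where
  "given_by_measure \<theta> \<nu> m \<longleftrightarrow> prob_space m \<and> sets m = sets borel \<and> (AE \<omega> in m. \<omega> \<in> Omega_star) \<and>
     (\<forall>f\<in>Fspace \<theta>. \<nu> f = (\<integral>\<omega>. f \<omega> \<partial>m))"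

definition eigen_triple ::
    "(omega \<Rightarrow> real) \<Rightarrow> real \<Rightarrow> complex \<Rightarrow> complex \<Rightarrow> (omega \<Rightarrow> complex) \<Rightarrow>
     ((omega \<Rightarrow> complex) \<Rightarrow> complex) \<Rightarrow> bool" where
  "eigen_triple V \<theta> z lz hz nz \<longleftrightarrow> hz \<in> Fspace \<theta> \<and> nz \<in> Fdual \<theta> \<and>
     transfer_op V z hz = (\<lambda>\<omega>. lz * hz \<omega>) \<and>
     (\<forall>f\<in>Fspace \<theta>. nz (transfer_op V z f) = lz * nz f) \<and>
     nz hz = 1"

text \<open>For \<open>0 < x \<le> 1\<close> the leading eigenvalue, positive eigenfunction and eigenmeasure.\<close>

definition leading_triple ::
    "(omega \<Rightarrow> real) \<Rightarrow> real \<Rightarrow> real \<Rightarrow> complex \<Rightarrow> (omega \<Rightarrow> complex) \<Rightarrow>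
     ((omega \<Rightarrow> complex) \<Rightarrow> complex) \<Rightarrow> bool" where
  "leading_triple V \<theta> x lx hx nx \<longleftrightarrow>
     eigen_triple V \<theta> (complex_of_real x) lx hx nx \<and>
     lx = complex_of_real (spectral_radius_op \<theta> (transfer_op V (complex_of_real x))) \<and>
     spectral_radius_op \<theta> (transfer_op V (complex_of_real x)) > 0 \<and>
     simple_eigenvalue \<theta> (transfer_op V (complex_of_real x)) lx \<and>
     (\<forall>\<omega>\<in>Omega_star. hx \<omega> \<in> \<real> \<and> Re (hx \<omega>) > 0) \<and>
     (\<exists>m. given_by_measure \<theta> nx m)"

text \<open>The operators are defined for \<open>|z| \<le> 1\<close> only, hence \<open>J\<close> is a neighbourhood relative to
  the closed unit disc: it may be an open subset of the open disc, or also contain boundary points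
  near 1. Holomorphy is required on \<open>J \<inter> ball 0 1\<close>, which is open. The point \<open>z = 0\<close> is exempted
  from \<open>\<lambda>\<^sub>z \<noteq> 0\<close>, since the operator at \<open>z = 0\<close> is 0 and therefore \<open>\<lambda>\<^sub>0 = 0\<close>.\<close>

definition spectral_data ::
    "(omega \<Rightarrow> real) \<Rightarrow> real \<Rightarrow> complex set \<Rightarrow> (complex \<Rightarrow> complex) \<Rightarrow>
     (complex \<Rightarrow> omega \<Rightarrow> complex) \<Rightarrow> (complex \<Rightarrow> (omega \<Rightarrow> complex) \<Rightarrow> complex) \<Rightarrow> bool" where
  "spectral_data V \<theta> J lam h \<nu> \<longleftrightarrow>
     openin (top_of_set (cball 0 1)) J \<and> complex_of_real ` {0..<1} \<subseteq> J \<and>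
     (\<forall>x. 0 < x \<and> x \<le> 1 \<longrightarrow>
        leading_triple V \<theta> x (lam (complex_of_real x)) (h (complex_of_real x)) (\<nu> (complex_of_real x))) \<and>
     lam 1 = 1 \<and>
     lam holomorphic_on (J \<inter> ball 0 1) \<and>
     holomorphic_family (Fspace \<theta>) (Fnorm \<theta>) (J \<inter> ball 0 1) h \<and>
     holomorphic_family (Fdual \<theta>) (Fdual_norm \<theta>) (J \<inter> ball 0 1) \<nu> \<and>
     (\<forall>z\<in>J \<union> {1}. eigen_triple V \<theta> z (lam z) (h z) (\<nu> z) \<and> (z \<noteq> 0 \<longrightarrow> lam z \<noteq> 0)) \<and>
     (\<exists>\<delta>>0. \<forall>z\<in>J \<union> {1}. dist z 1 < \<delta> \<longrightarrow> spectral_radius_op \<theta> (N_op V z (lam z) (h z) (\<nu> z)) < 1)"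

section \<open>The invariant measure and the correlation generating function\<close>

text \<open>Here \<open>h\<close> and \<open>m\<close> are the eigenfunction and eigenmeasure at \<open>z = 1\<close>. The values of \<open>L\<^sub>0\<^sup>k h\<close>
  are nonnegative reals, so taking \<open>Re\<close> only changes the type. Since \<open>m\<close> is a Borel measure on
  the full shift concentrated on \<open>Omega_star\<close>, so is \<open>mu\<close>.\<close>

definition density_e :: "(omega \<Rightarrow> real) \<Rightarrow> (omega \<Rightarrow> complex) \<Rightarrow> omega \<Rightarrow> ennreal" where
  "density_e V h \<omega> = (\<Sum>k. ennreal (Re ((L0_op V ^^ k) h \<omega>)))"

definition mu :: "(omega \<Rightarrow> real) \<Rightarrow> (omega \<Rightarrow> complex) \<Rightarrow> omega measure \<Rightarrow> omega measure" where
  "mu V h m = density m (density_e V h)"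

definition ucorr :: "(omega \<Rightarrow> real) \<Rightarrow> (omega \<Rightarrow> complex) \<Rightarrow> omega measure \<Rightarrow> nat \<Rightarrow> real" where
  "ucorr V h m n = measure (mu V h m) (level 1 \<inter> (shift ^^ n) -` level 1)"

definition Sgen :: "(omega \<Rightarrow> real) \<Rightarrow> (omega \<Rightarrow> complex) \<Rightarrow> omega measure \<Rightarrow> complex \<Rightarrow> complex" where
  "Sgen V h m z = (\<Sum>n. z ^ n * complex_of_real (ucorr V h m n))"

end

theory Submission
  imports Defs
begin

text \<open>
  Conjugating \<open>M\<^sub>z\<close> by the eigenfunction \<open>h\<close> turns it into \<open>A\<^sub>z f(x) = \<Sum>\<^sub>n z\<^sup>n\<^sup>+\<^sup>1 p\<^sub>n(x) f(0\<^sup>n1x)\<close> with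
  probability weights \<open>p\<^sub>n(x)\<close> that depend on \<open>x\<close> in a Lipschitz way. One application of \<open>A\<^sub>z\<close> contracts Lipschitz
  constants up to a multiple of the sup norm. For \<open>|z| \<le> 1\<close>, \<open>z \<noteq> 1\<close>, two words that share their first
  \<open>m\<close> blocks but differ by one in length contribute almost the same value of \<open>f\<close> with phases that
  differ by \<open>z\<close>, so a fixed power of \<open>A\<^sub>z\<close> also contracts the sup norm, uniformly for \<open>|z - 1| \<ge> \<epsilon>\<close>.
  Hence \<open>(1 - A\<^sub>z)\<^sup>-\<^sup>1 = \<Sum>\<^sub>j A\<^sub>z\<^sup>j\<close> converges on the whole punctured closed disc, locally uniformly,
  without any appeal to quasi-compactness.

  The probability measure \<open>h \<nu>\<close> is stationary for \<open>p\<close>, and \<open>u\<^sub>n\<close> is the probability that \<open>n\<close> is a renewal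
  epoch of the chain of blocks. The renewal equation gives \<open>S(z) = \<nu>((1 - M\<^sub>z)\<^sup>-\<^sup>1 h)\<close> for \<open>|z| < 1\<close>, whose
  right-hand side is continuous on the punctured closed disc; splitting off the spectral projection
  is linear algebra.
\<close>

section \<open>Blocks and the metric\<close>

text \<open>At \<open>z = 1\<close> the constant function is a fixed point of \<open>A z\<close>, so
  the sup norm can shrink only through the phases. The blocks \<open>1\<close> and \<open>01\<close>
  suffice for this: their lengths are 1 and 2, and boundedness of \<open>V\<close> together with
  two-sided bounds on the eigenfunction keeps their weights away from 0. Two obstacles shape the
  probabilistic half. The eigenmeasure relation is given on Lipschitz functions, while the density
  of \<open>mu\<close> and the event "a one at position \<open>n\<close>" call for Borel functions;
  cylinder sets, whose indicators are Lipschitz, bridge the gap. And the generating function of the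
  renewal probabilities is known only to be bounded, so inside the disc it is identified with the
  Neumann series by a sup-norm argument; on the circle the Neumann series itself supplies the
  values.\<close>

lemma pre_apply:
  "pre n x i = (if i < n then False else if i = n then True else x (i - Suc n))"
  by (auto simp: pre_def prepend_def nth_append)

lemma tau_pre [simp]: "tau (pre n x) = enat (Suc n)"
proof -
  have "Inf {enat i |i. pre n x i} = enat n"
    by (rule antisym) (auto intro!: Inf_lower Inf_greatest simp: pre_apply split: if_splits)
  then show ?thesis by (simp add: tau_def one_enat_def)
qed

lemma funpow_shift: "(shift ^^ k) x = (\<lambda>i. x (i + k))"
  by (induction k) (auto simp: shift_def)

lemma induced_shift_pre [simp]: "induced_shift (pre n x) = x"
  by (rule ext) (simp add: induced_shift_def funpow_shift pre_apply del: funpow.simps)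

lemma sigma_pre_0 [simp]: "sigma 0 (pre n x) = enat (Suc n)"
  by (simp add: sigma_def)

lemma sigma_pre_Suc [simp]: "sigma (Suc k) (pre n x) = sigma k x"
  unfolding sigma_def by (simp only: funpow_Suc_right comp_def induced_shift_pre)

lemma pre_in_star [simp]: "pre n x \<in> Omega_star \<longleftrightarrow> x \<in> Omega_star"
proof -
  have "{i. pre n x i} = insert n ((\<lambda>i. i + Suc n) ` {i. x i})"
  proof (intro set_eqI iffI)
    fix i assume "i \<in> {i. pre n x i}"
    then show "i \<in> insert n ((\<lambda>i. i + Suc n) ` {i. x i})"
      by (auto simp: pre_apply image_iff split: if_splits intro!: exI[of _ "i - Suc n"])
  qed (auto simp: pre_apply)
  then show ?thesis
    by (simp add: Omega_star_def finite_image_iff inj_on_def)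
qed

lemma star_pre_cases:
  assumes "x \<in> Omega_star"
  obtains n y where "x = pre n y" "y \<in> Omega_star"
proof -
  have "\<exists>i. x i" using assms by (auto simp: Omega_star_def dest: not_finite_existsD)
  define n where "n = (LEAST i. x i)"
  have "x n" and "\<And>i. i < n \<Longrightarrow> \<not> x i"
    using \<open>\<exists>i. x i\<close> by (auto simp: n_def intro: LeastI_ex dest: not_less_Least)
  then have "x = pre n (\<lambda>i. x (i + Suc n))"
    by (auto simp: pre_apply fun_eq_iff)
  with assms that show ?thesis by (metis pre_in_star)
qed

text \<open>Each block has length at least 1, so the first \<open>i + 1\<close> blocks cover
  position \<open>i\<close>. In particular, points of \<open>Omega_star\<close> with the same
  passage times are equal.\<close>

lemma coordinate_of_sigma:
  assumes "x \<in> Omega_star" "y \<in> Omega_star" "\<And>k. k \<le> i \<Longrightarrow> sigma k x = sigma k y"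
  shows "x i = y i"
  using assms
proof (induction i arbitrary: x y rule: less_induct)
  case (less i)
  obtain n x' where x: "x = pre n x'" "x' \<in> Omega_star" using less.prems(1) by (rule star_pre_cases)
  obtain l y' where y: "y = pre l y'" "y' \<in> Omega_star" using less.prems(2) by (rule star_pre_cases)
  have "l = n" using less.prems(3)[of 0] by (simp add: x y)
  have "x' (i - Suc n) = y' (i - Suc n)" if "n < i"
  proof (rule less.IH)
    fix k assume "k \<le> i - Suc n"
    then show "sigma k x' = sigma k y'"
      using less.prems(3)[of "Suc k"] that by (simp add: x y)
  qed (use that x y in auto)
  then show ?case by (auto simp: x y \<open>l = n\<close> pre_apply)
qed

text \<open>\<open>N\<close> depends on \<open>x\<close>: block lengths are unbounded, so no fixed
  number of coordinates determines the first \<open>k\<close> blocks of every point. Pointwise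
  control is enough for measurability.\<close>

lemma sigma_of_coordinates:
  assumes "x \<in> Omega_star"
  shows "\<exists>N. \<forall>y\<in>Omega_star. (\<forall>i<N. y i = x i) \<longrightarrow> (\<forall>j<k. sigma j y = sigma j x)"
  using assms
proof (induction k arbitrary: x)
  case (Suc k)
  obtain n x' where x: "x = pre n x'" "x' \<in> Omega_star" using Suc.prems by (rule star_pre_cases)
  obtain N where N: "\<And>y. y \<in> Omega_star \<Longrightarrow> (\<forall>i<N. y i = x' i) \<Longrightarrow> \<forall>j<k. sigma j y = sigma j x'"
    using Suc.IH[OF x(2)] by blast
  have "\<forall>j<Suc k. sigma j y = sigma j x"
    if y: "y \<in> Omega_star" "\<forall>i<Suc n + N. y i = x i" for y
  proof -
    define y' where "y' = (\<lambda>i. y (i + Suc n))"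
    have "y = pre n y'"
    proof (rule ext)
      fix i show "y i = pre n y' i"
        using y(2)[rule_format, of i] by (auto simp: y'_def pre_apply x split: if_splits)
    qed
    moreover have "y' i = x' i" if "i < N" for i
      using y(2)[rule_format, of "i + Suc n"] that by (simp add: y'_def x pre_apply)
    ultimately show ?thesis
      using N[of y'] y(1) by (auto simp: x less_Suc_eq_0_disj)
  qed
  then show ?case by blast
qed auto

lemma dtheta_eqI:
  assumes "\<And>j. j < k \<Longrightarrow> sigma j x = sigma j y" "sigma k x \<noteq> sigma k y"
  shows "sep x y = enat k" "dtheta \<theta> x y = \<theta> ^ k"
proof -
  have "k \<le> j" if "sigma j x \<noteq> sigma j y" for j
    using assms(1) that by (meson not_le_imp_less)
  then show "sep x y = enat k"
    unfolding sep_def using assms(2) by (intro antisym Inf_lower Inf_greatest) auto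
  then show "dtheta \<theta> x y = \<theta> ^ k" by (simp add: dtheta_def)
qed

lemma dtheta_cases:
  obtains (equal) "\<And>j. sigma j x = sigma j y" "dtheta \<theta> x y = 0"
  | (differ) k where "\<And>j. j < k \<Longrightarrow> sigma j x = sigma j y" "sigma k x \<noteq> sigma k y"
      "sep x y = enat k" "dtheta \<theta> x y = \<theta> ^ k"
proof (cases "\<exists>j. sigma j x \<noteq> sigma j y")
  case True
  define k where "k = (LEAST j. sigma j x \<noteq> sigma j y)"
  have "sigma k x \<noteq> sigma k y"
    unfolding k_def using True by (rule LeastI_ex)
  moreover have "\<And>j. j < k \<Longrightarrow> sigma j x = sigma j y"
    unfolding k_def using not_less_Least by blast
  ultimately show ?thesis using differ dtheta_eqI by blast
next
  case False
  then have "sep x y = \<infinity>" by (simp add: sep_def top_enat_def)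
  then show ?thesis using equal False by (simp add: dtheta_def)
qed

locale block_metric =
  fixes \<theta> :: real
  assumes theta: "0 < \<theta>" "\<theta> < 1"
begin

lemma dtheta_nonneg: "0 \<le> dtheta \<theta> x y"
  using theta by (cases rule: dtheta_cases[of x y \<theta>]) auto

lemma dtheta_le_1: "dtheta \<theta> x y \<le> 1"
  using theta by (cases rule: dtheta_cases[of x y \<theta>]) (auto intro: power_le_one)

text \<open>A common block in front delays the first disagreement by one index. This factor
  \<open>\<theta>\<close> is the source of every contraction of Lipschitz constants below.\<close>

lemma dtheta_pre: "dtheta \<theta> (pre n x) (pre n y) = \<theta> * dtheta \<theta> x y"
proof (cases rule: dtheta_cases[of x y \<theta>])
  case equal
  have "sigma j (pre n x) = sigma j (pre n y)" for j
    using equal(1) by (cases j) auto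
  then have "sep (pre n x) (pre n y) = \<infinity>" by (simp add: sep_def top_enat_def)
  then show ?thesis unfolding equal(2) by (simp add: dtheta_def)
next
  case (differ k)
  have "dtheta \<theta> (pre n x) (pre n y) = \<theta> ^ Suc k"
    by (rule dtheta_eqI) (use differ in \<open>auto simp: less_Suc_eq_0_disj\<close>)
  then show ?thesis by (simp add: differ)
qed

lemma dtheta_le_power:
  assumes "\<And>j. j < k \<Longrightarrow> sigma j x = sigma j y"
  shows "dtheta \<theta> x y \<le> \<theta> ^ k"
proof (cases rule: dtheta_cases[of x y \<theta>])
  case (differ l)
  then have "k \<le> l" using assms by (meson not_le_imp_less)
  then show ?thesis using differ theta by (simp add: power_decreasing)
qed (use theta in auto)

lemma power_le_dtheta:
  assumes "x \<in> Omega_star" "y \<in> Omega_star" "x i \<noteq> y i"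
  shows "\<theta> ^ i \<le> dtheta \<theta> x y"
proof (cases rule: dtheta_cases[of x y \<theta>])
  case equal
  then show ?thesis using coordinate_of_sigma assms by blast
next
  case (differ k)
  then have "k \<le> i" using coordinate_of_sigma[OF assms(1,2), of i] assms(3)
    by (meson le_less_trans not_le_imp_less)
  then show ?thesis using differ theta by (simp add: power_decreasing)
qed

section \<open>The Lipschitz space as an algebra containing the cut-off cylinder functions\<close>

lemma FspaceI:
  assumes "\<And>x. x \<notin> Omega_star \<Longrightarrow> f x = 0" "\<And>x. x \<in> Omega_star \<Longrightarrow> cmod (f x) \<le> s" "is_Lip \<theta> f L"
  shows "f \<in> Fspace \<theta>"
  using assms unfolding Fspace_def bounded_iff by blast

lemma FspaceE:
  assumes "f \<in> Fspace \<theta>"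
  obtains s L where "0 \<le> s" "\<And>x. cmod (f x) \<le> s" "is_Lip \<theta> f L"
proof -
  obtain s where "\<And>x. x \<in> Omega_star \<Longrightarrow> cmod (f x) \<le> s"
    using assms by (auto simp: Fspace_def bounded_iff)
  then have "cmod (f x) \<le> max s 0" for x
    using assms by (cases "x \<in> Omega_star") (auto simp: Fspace_def le_max_iff_disj)
  then show ?thesis using that[of "max s 0"] assms by (auto simp: Fspace_def)
qed

lemma Fspace_off: "f \<in> Fspace \<theta> \<Longrightarrow> x \<notin> Omega_star \<Longrightarrow> f x = 0"
  by (simp add: Fspace_def)

lemma Fspace_add:
  assumes "f \<in> Fspace \<theta>" "g \<in> Fspace \<theta>"
  shows "(\<lambda>x. f x + g x) \<in> Fspace \<theta>"
proof -
  obtain s L where f: "\<And>x. cmod (f x) \<le> s" "is_Lip \<theta> f L" using FspaceE[OF assms(1)] by blast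
  obtain t M where g: "\<And>x. cmod (g x) \<le> t" "is_Lip \<theta> g M" using FspaceE[OF assms(2)] by blast
  show ?thesis
  proof (rule FspaceI)
    show "cmod (f x + g x) \<le> s + t" for x
      by (rule order.trans[OF norm_triangle_ineq add_mono[OF f(1) g(1)]])
    have "cmod ((f x + g x) - (f y + g y)) \<le> (L + M) * dtheta \<theta> x y"
      if "x \<in> Omega_star" "y \<in> Omega_star" for x y
    proof -
      have "cmod ((f x + g x) - (f y + g y)) \<le> cmod (f x - f y) + cmod (g x - g y)"
        by (metis add_diff_add norm_triangle_ineq)
      also have "\<dots> \<le> L * dtheta \<theta> x y + M * dtheta \<theta> x y"
        using f(2) g(2) that by (intro add_mono) (auto simp: is_Lip_def)
      finally show ?thesis by (simp add: algebra_simps)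
    qed
    then show "is_Lip \<theta> (\<lambda>x. f x + g x) (L + M)"
      using f(2) g(2) by (auto simp: is_Lip_def)
  qed (use assms in \<open>simp add: Fspace_off\<close>)
qed

lemma Fspace_mult:
  assumes "f \<in> Fspace \<theta>" "g \<in> Fspace \<theta>"
  shows "(\<lambda>x. f x * g x) \<in> Fspace \<theta>"
proof -
  obtain s L where f: "0 \<le> s" "\<And>x. cmod (f x) \<le> s" "is_Lip \<theta> f L" using FspaceE[OF assms(1)] by blast
  obtain t M where g: "0 \<le> t" "\<And>x. cmod (g x) \<le> t" "is_Lip \<theta> g M" using FspaceE[OF assms(2)] by blast
  show ?thesis
  proof (rule FspaceI)
    show "cmod (f x * g x) \<le> s * t" for x
      unfolding norm_mult by (rule mult_mono[OF f(2) g(2) f(1)]) simp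
    have "cmod (f x * g x - f y * g y) \<le> (s * M + t * L) * dtheta \<theta> x y"
      if "x \<in> Omega_star" "y \<in> Omega_star" for x y
    proof -
      have "f x * g x - f y * g y = f x * (g x - g y) + (f x - f y) * g y"
        by (simp add: algebra_simps)
      also have "cmod \<dots> \<le> cmod (f x) * cmod (g x - g y) + cmod (f x - f y) * cmod (g y)"
        by (metis norm_mult norm_triangle_ineq)
      also have "\<dots> \<le> s * (M * dtheta \<theta> x y) + (L * dtheta \<theta> x y) * t"
        using f g that dtheta_nonneg[of x y] by (intro add_mono mult_mono) (auto simp: is_Lip_def)
      finally show ?thesis by (simp add: algebra_simps)
    qed
    then show "is_Lip \<theta> (\<lambda>x. f x * g x) (s * M + t * L)"
      using f g by (auto simp: is_Lip_def)
  qed (use assms in \<open>simp add: Fspace_off\<close>)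
qed

text \<open>Points of \<open>Omega_star\<close> that differ in the first \<open>N\<close>
  coordinates are at least \<open>\<theta> ^ N\<close> apart, so boundedness alone yields a
  Lipschitz constant. These functions link the Lipschitz space with the Borel structure.\<close>

lemma Fspace_cylinder:
  assumes "\<And>x y. (\<And>i. i < N \<Longrightarrow> x i = y i) \<Longrightarrow> f x = f y" "\<And>x. cmod (f x) \<le> s"
  shows "(\<lambda>x. if x \<in> Omega_star then f x else 0) \<in> Fspace \<theta>"
proof (rule FspaceI)
  have s: "0 \<le> s" using order.trans[OF norm_ge_zero assms(2)] .
  show "cmod (if x \<in> Omega_star then f x else 0) \<le> s" for x using s assms(2) by auto
  have "cmod (f x - f y) \<le> (2 * s / \<theta> ^ N) * dtheta \<theta> x y"
    if xy: "x \<in> Omega_star" "y \<in> Omega_star" for x y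
  proof (cases "\<forall>i<N. x i = y i")
    case True
    then have "f x = f y" using assms(1) by blast
    then show ?thesis using s theta dtheta_nonneg by simp
  next
    case False
    then obtain i where i: "i < N" "x i \<noteq> y i" by blast
    have "\<theta> ^ N \<le> \<theta> ^ i" using i theta by (simp add: power_decreasing)
    then have d: "\<theta> ^ N \<le> dtheta \<theta> x y" using power_le_dtheta[OF xy i(2)] by simp
    have "cmod (f x - f y) \<le> s + s"
      by (rule order.trans[OF norm_triangle_ineq4 add_mono[OF assms(2) assms(2)]])
    also have "\<dots> \<le> 2 * s * (dtheta \<theta> x y / \<theta> ^ N)"
      using d theta s mult_left_mono[of 1 "dtheta \<theta> x y / \<theta> ^ N" "2 * s"] by simp
    finally show ?thesis by simp
  qed
  then show "is_Lip \<theta> (\<lambda>x. if x \<in> Omega_star then f x else 0) (2 * s / \<theta> ^ N)"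
    using s theta by (auto simp: is_Lip_def)
qed auto

lemma Fspace_scale:
  assumes "f \<in> Fspace \<theta>"
  shows "(\<lambda>x. c * f x) \<in> Fspace \<theta>"
proof -
  \<comment> \<open>A nonzero constant does not vanish off \<open>Omega_star\<close>; its cut-off is
    a cylinder function and gives the same product with \<open>f\<close>.\<close>
  have "(\<lambda>x. (if x \<in> Omega_star then c else 0) * f x) \<in> Fspace \<theta>"
    using Fspace_cylinder[of 0 "\<lambda>_. c" "cmod c"] assms by (intro Fspace_mult) auto
  also have "(\<lambda>x. (if x \<in> Omega_star then c else 0) * f x) = (\<lambda>x. c * f x)"
    using assms by (auto simp: Fspace_off)
  finally show ?thesis .
qed

end

section \<open>Measurability of Lipschitz functions\<close>

lemma measurable_coordinate [measurable]: "Measurable.pred borel (\<lambda>x::omega. x i)"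
proof -
  have "(\<lambda>x::omega. x i) -` {True} \<inter> space borel \<in> sets borel"
    by (rule measurable_sets[OF measurable_product_coordinates]) (simp add: open_discrete borel_open)
  then show ?thesis by (simp add: pred_def vimage_def)
qed

lemma sets_Omega_star [measurable]: "Omega_star \<in> sets borel"
proof -
  have "Omega_star = {x \<in> space borel. \<forall>N::nat. \<exists>i::nat. N < i \<and> x i}"
    by (auto simp: Omega_star_def infinite_nat_iff_unbounded)
  also have "\<dots> \<in> sets borel" by measurable
  finally show ?thesis .
qed

lemma continuous_on_shift: "continuous_on UNIV ((shift ^^ k) :: omega \<Rightarrow> omega)"
  unfolding funpow_shift
  by (intro continuous_on_coordinatewise_then_product continuous_on_product_coordinates)

lemma continuous_on_prepend: "continuous_on UNIV (prepend w)"
proof (rule continuous_on_coordinatewise_then_product)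
  fix i show "continuous_on UNIV (\<lambda>x. prepend w x i)"
    by (cases "i < length w") (simp_all add: prepend_def continuous_on_product_coordinates)
qed

lemma measurable_shift [measurable]: "(shift ^^ k) \<in> borel_measurable borel"
  by (rule borel_measurable_continuous_onI[OF continuous_on_shift])

lemma measurable_prepend [measurable]: "prepend w \<in> borel_measurable borel"
  by (rule borel_measurable_continuous_onI[OF continuous_on_prepend])

lemma measurable_pre [measurable]: "pre n \<in> borel_measurable borel"
  unfolding pre_def[abs_def] by measurable

text \<open>Filling up with ones keeps the truncation inside \<open>Omega_star\<close>, where
  Lipschitz bounds apply.\<close>

definition trunc :: "nat \<Rightarrow> omega \<Rightarrow> omega" where
  "trunc N x = (\<lambda>i. if i < N then x i else True)"

lemma trunc_in_star: "trunc N x \<in> Omega_star"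
proof -
  have "{N..} \<subseteq> {i. trunc N x i}" by (auto simp: trunc_def)
  then show ?thesis
    unfolding Omega_star_def using infinite_Ici infinite_super by blast
qed

text \<open>\<open>f\<close> may be arbitrary because \<open>trunc N\<close> takes finitely many
  values. The induction tests coordinate \<open>N\<close>, at which \<open>trunc N x\<close> already
  has a one.\<close>

lemma measurable_comp_trunc: "(\<lambda>x. f (trunc N x)) \<in> borel_measurable borel"
  for f :: "omega \<Rightarrow> 'b::topological_space"
proof (induction N arbitrary: f)
  case 0
  then show ?case by (simp add: trunc_def)
next
  case (Suc N)
  have "f (trunc (Suc N) x) = (if x N then f (trunc N x) else f ((trunc N x)(N := False)))" for x
    by (auto intro!: arg_cong[where f = f] simp: trunc_def less_Suc_eq)
  moreover have "(\<lambda>x. f ((trunc N x)(N := False))) \<in> borel_measurable borel"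
    using Suc.IH[of "\<lambda>y. f (y(N := False))"] by simp
  ultimately show ?case using Suc.IH[of f] by simp
qed

text \<open>At each \<open>x\<close> in \<open>Omega_star\<close> the truncations converge to
  \<open>x\<close> in \<open>dtheta\<close>, so \<open>f\<close> is there a pointwise limit of
  functions of finitely many coordinates.\<close>

lemma (in block_metric) Fspace_measurable:
  assumes f: "f \<in> Fspace \<theta>"
  shows "f \<in> borel_measurable borel"
proof -
  obtain s L where L: "is_Lip \<theta> f L" using FspaceE[OF f] by blast
  define g where "g N x = (if x \<in> Omega_star then f (trunc N x) else 0)" for N x
  have "(\<lambda>N. g N x) \<longlonglongrightarrow> f x" for x
  proof (cases "x \<in> Omega_star")
    case True
    have "(\<lambda>N. dtheta \<theta> (trunc N x) x) \<longlonglongrightarrow> 0"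
    proof (rule LIMSEQ_I)
      fix r :: real assume "r > 0"
      obtain k where k: "\<theta> ^ k < r" using real_arch_pow_inv[OF \<open>r > 0\<close> theta(2)] by blast
      obtain N where "\<And>y. y \<in> Omega_star \<Longrightarrow> (\<forall>i<N. y i = x i) \<Longrightarrow> \<forall>j<k. sigma j y = sigma j x"
        using sigma_of_coordinates[OF True, of k] by blast
      then have N: "\<forall>j<k. sigma j (trunc n x) = sigma j x" if "n \<ge> N" for n
        using that trunc_in_star by (simp add: trunc_def)
      show "\<exists>no. \<forall>n\<ge>no. norm (dtheta \<theta> (trunc n x) x - 0) < r"
      proof (intro exI[of _ N] allI impI)
        fix n assume "N \<le> n"
        then have "dtheta \<theta> (trunc n x) x \<le> \<theta> ^ k"
          using N by (intro dtheta_le_power) auto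
        then show "norm (dtheta \<theta> (trunc n x) x - 0) < r"
          using k dtheta_nonneg by simp
      qed
    qed
    then have "(\<lambda>N. L * dtheta \<theta> (trunc N x) x) \<longlonglongrightarrow> 0" by (rule tendsto_mult_right_zero)
    then have "(\<lambda>N. f (trunc N x) - f x) \<longlonglongrightarrow> 0"
      by (rule Lim_null_comparison[rotated]) (use L True trunc_in_star in \<open>auto simp: is_Lip_def\<close>)
    then show ?thesis using True by (simp add: g_def LIM_zero_iff)
  next
    case False
    then show ?thesis using f by (simp add: g_def Fspace_off)
  qed
  moreover have "g N \<in> borel_measurable borel" for N
  proof -
    note measurable_comp_trunc[of f N, measurable]
    show ?thesis unfolding g_def by measurable
  qed
  ultimately show ?thesis using borel_measurable_LIMSEQ_metric[of g borel f] by blast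
qed

section \<open>Contraction for chains of blocks\<close>

text \<open>The bound \<open>p_Lip\<close> is relative to \<open>p n x\<close>, so summation over
  \<open>n\<close> costs only the constant \<open>K\<close>. The blocks in \<open>p_ge\<close> are
  \<open>1\<close> and \<open>01\<close>; their lengths differ by one, which plays the role of
  aperiodicity.\<close>

locale block_chain = block_metric +
  fixes p :: "nat \<Rightarrow> omega \<Rightarrow> real" and K c :: real
  assumes K_pos: "0 < K" and c_pos: "0 < c"
    and p_nonneg: "0 \<le> p n x"
    and p_off: "x \<notin> Omega_star \<Longrightarrow> p n x = 0"
    and p_sums: "x \<in> Omega_star \<Longrightarrow> (\<lambda>n. p n x) sums 1"
    and p_Lip: "x \<in> Omega_star \<Longrightarrow> y \<in> Omega_star \<Longrightarrow> \<bar>p n x - p n y\<bar> \<le> K * p n x * dtheta \<theta> x y"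
    and p_ge: "x \<in> Omega_star \<Longrightarrow> n \<le> 1 \<Longrightarrow> c \<le> p n x"
begin

definition A :: "complex \<Rightarrow> (omega \<Rightarrow> complex) \<Rightarrow> omega \<Rightarrow> complex" where
  "A z f x = (\<Sum>n. z ^ Suc n * of_real (p n x) * f (pre n x))"

lemma norm_A_term:
  assumes "cmod z \<le> 1" "cmod w \<le> s"
  shows "cmod (z ^ n * of_real (p k x) * w) \<le> p k x * s"
proof -
  have "cmod (z ^ n * of_real (p k x) * w) = cmod z ^ n * (p k x * cmod w)"
    by (simp add: norm_mult norm_power p_nonneg)
  also have "\<dots> \<le> 1 * (p k x * s)"
    using assms by (intro mult_mono power_le_one) (auto simp: p_nonneg mult_left_mono)
  finally show ?thesis by simp
qed

lemma summable_p: "summable (\<lambda>n. p n x)"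
  using p_sums p_off by (cases "x \<in> Omega_star") (auto simp: sums_iff)

lemma suminf_p: "x \<in> Omega_star \<Longrightarrow> (\<Sum>n. p n x) = 1"
  using p_sums by (simp add: sums_iff)

lemma summable_A:
  assumes "cmod z \<le> 1" "\<And>x. x \<in> Omega_star \<Longrightarrow> cmod (f x) \<le> s"
  shows "summable (\<lambda>n. z ^ Suc n * of_real (p n x) * f (pre n x))"
proof (cases "x \<in> Omega_star")
  case True
  show ?thesis
    by (rule summable_comparison_test'[OF summable_mult2[OF summable_p[of x], of s]])
      (use assms True norm_A_term in \<open>auto simp del: power_Suc\<close>)
qed (simp add: p_off)

lemma A_off: "x \<notin> Omega_star \<Longrightarrow> A z f x = 0"
  by (simp add: A_def p_off)

text \<open>The weight not spent on the first \<open>k\<close> blocks is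
  \<open>1 - (\<Sum>n<k. p n x)\<close>. The case \<open>k = 0\<close> is the sup-norm bound;
  \<open>k = 1\<close> and \<open>k = 2\<close> isolate chosen blocks and estimate the others
  trivially.\<close>

lemma A_split:
  assumes z: "cmod z \<le> 1" and f: "\<And>x. x \<in> Omega_star \<Longrightarrow> cmod (f x) \<le> s"
    and x: "x \<in> Omega_star"
  shows "cmod (A z f x - (\<Sum>n<k. z ^ Suc n * of_real (p n x) * f (pre n x)))
    \<le> (1 - (\<Sum>n<k. p n x)) * s"
proof -
  let ?t = "\<lambda>n. z ^ Suc n * of_real (p n x) * f (pre n x)"
  have "A z f x - (\<Sum>n<k. ?t n) = (\<Sum>n. ?t (n + k))"
    using suminf_split_initial_segment[OF summable_A[where z = z and f = f and x = x, OF z f], of k]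
    by (simp add: A_def)
  also have "cmod \<dots> \<le> (\<Sum>n. p (n + k) x * s)"
    by (rule norm_suminf_le)
      (use z f x norm_A_term summable_p[of x] in
        \<open>auto simp del: power_Suc intro!: summable_mult2 summable_ignore_initial_segment\<close>)
  also have "\<dots> = (\<Sum>n. p (n + k) x) * s"
    by (intro suminf_mult2[symmetric] summable_ignore_initial_segment summable_p)
  also have "(\<Sum>n. p (n + k) x) = 1 - (\<Sum>n<k. p n x)"
    using suminf_split_initial_segment[OF summable_p[of x], of k] suminf_p[OF x] by simp
  finally show ?thesis .
qed

lemma norm_A_le:
  assumes "cmod z \<le> 1" "\<And>x. x \<in> Omega_star \<Longrightarrow> cmod (f x) \<le> s" "x \<in> Omega_star"
  shows "cmod (A z f x) \<le> s"
  using A_split[OF assms, where k = 0] by simp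

lemma A_add:
  assumes "cmod z \<le> 1" "\<And>x. x \<in> Omega_star \<Longrightarrow> cmod (f x) \<le> s"
    "\<And>x. x \<in> Omega_star \<Longrightarrow> cmod (g x) \<le> t"
  shows "A z (\<lambda>x. f x + g x) x = A z f x + A z g x"
  unfolding A_def distrib_left
  by (intro suminf_add[symmetric] summable_A) (use assms in auto)

lemma A_cmult:
  assumes "cmod z \<le> 1" "\<And>x. x \<in> Omega_star \<Longrightarrow> cmod (f x) \<le> s"
  shows "A z (\<lambda>x. b * f x) x = b * A z f x"
proof -
  have "(\<lambda>n. z ^ Suc n * of_real (p n x) * (b * f (pre n x))) =
      (\<lambda>n. b * (z ^ Suc n * of_real (p n x) * f (pre n x)))" by (simp add: mult_ac)
  then show ?thesis
    unfolding A_def using suminf_mult[OF summable_A[OF assms]] by simp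
qed

text \<open>A Doeblin-Fortet inequality: the common block contributes \<open>\<theta> * L\<close>,
  the variation of the weights \<open>K * s\<close>.\<close>

lemma A_Lip:
  assumes z: "cmod z \<le> 1" and f: "\<And>x. x \<in> Omega_star \<Longrightarrow> cmod (f x) \<le> s" and L: "is_Lip \<theta> f L"
  shows "is_Lip \<theta> (A z f) (\<theta> * L + K * s)"
proof -
  have "(\<lambda>i. True) \<in> Omega_star" by (simp add: Omega_star_def)
  then have s: "0 \<le> s" using order.trans[OF norm_ge_zero f] by blast
  have L0: "0 \<le> L" using L by (simp add: is_Lip_def)
  have "cmod (A z f x - A z f y) \<le> (\<theta> * L + K * s) * dtheta \<theta> x y"
    if xy: "x \<in> Omega_star" "y \<in> Omega_star" for x y
  proof -
    let ?d = "dtheta \<theta> x y"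
    let ?t = "\<lambda>x n. z ^ Suc n * of_real (p n x) * f (pre n x)"
    have "cmod (?t x n - ?t y n) \<le> p n x * ((\<theta> * L + K * s) * ?d)" for n
    proof -
      \<comment> \<open>The splitting is arranged so that both error terms carry the factor
        \<open>p n x\<close>, whose sum over \<open>n\<close> is 1.\<close>
      have "cmod (?t x n - ?t y n) = cmod (z ^ Suc n *
          (of_real (p n x) * (f (pre n x) - f (pre n y)) + of_real (p n x - p n y) * f (pre n y)))"
        by (rule arg_cong[where f = cmod]) (simp add: algebra_simps)
      also have "\<dots> \<le> 1 * (p n x * cmod (f (pre n x) - f (pre n y)) +
          \<bar>p n x - p n y\<bar> * cmod (f (pre n y)))"
        unfolding norm_mult norm_power using z
        by (intro mult_mono power_le_one order.trans[OF norm_triangle_ineq])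
          (auto simp: norm_mult p_nonneg simp del: of_real_diff)
      also have "\<dots> \<le> 1 * (p n x * (L * (\<theta> * ?d)) + (K * p n x * ?d) * s)"
      proof -
        have "cmod (f (pre n x) - f (pre n y)) \<le> L * dtheta \<theta> (pre n x) (pre n y)"
          using L xy by (simp add: is_Lip_def)
        then show ?thesis
          using f[of "pre n y"] p_Lip[OF xy, of n] xy s K_pos
          by (intro mult_left_mono add_mono mult_mono)
            (auto simp: p_nonneg dtheta_nonneg dtheta_pre)
      qed
      finally show ?thesis by (simp add: algebra_simps)
    qed
    then have "cmod (\<Sum>n. ?t x n - ?t y n) \<le> (\<Sum>n. p n x * ((\<theta> * L + K * s) * ?d))"
      by (intro norm_suminf_le summable_mult2 summable_p)
    also have "\<dots> = (\<theta> * L + K * s) * ?d"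
      using suminf_mult2[OF summable_p[of x]] suminf_p[OF xy(1)] by simp
    also have "(\<Sum>n. ?t x n - ?t y n) = A z f x - A z f y"
      unfolding A_def
      by (rule suminf_diff[symmetric])
        (rule summable_A[where f = f, OF z f], assumption)+
    finally show ?thesis .
  qed
  then show ?thesis
    using theta K_pos s L0 by (auto simp: is_Lip_def)
qed

section \<open>Balls adapted to the contraction of Lipschitz constants\<close>

definition M :: real where "M = 2 * K / (1 - \<theta>)"

lemma M_pos: "0 < M"
  using K_pos theta by (simp add: M_def)

text \<open>The ball of radius \<open>s\<close> for the norm \<open>max (sup \<bar>f\<bar>) (Lip f / M)\<close>; with this weight the
  Lipschitz part already contracts under one application of \<^term>\<open>A z\<close>.\<close>

definition ctrl :: "real \<Rightarrow> (omega \<Rightarrow> complex) \<Rightarrow> bool" where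
  "ctrl s f \<longleftrightarrow> (\<forall>x. x \<notin> Omega_star \<longrightarrow> f x = 0) \<and> (\<forall>x\<in>Omega_star. cmod (f x) \<le> s) \<and>
     is_Lip \<theta> f (M * s)"

lemma ctrl_norm: "ctrl s f \<Longrightarrow> x \<in> Omega_star \<Longrightarrow> cmod (f x) \<le> s"
  by (simp add: ctrl_def)

lemma ctrl_nonneg: "ctrl s f \<Longrightarrow> 0 \<le> s"
  using M_pos by (simp add: ctrl_def is_Lip_def zero_le_mult_iff)

lemma is_Lip_mono: "is_Lip \<theta> f L \<Longrightarrow> L \<le> L' \<Longrightarrow> is_Lip \<theta> f L'"
  unfolding is_Lip_def by (meson dtheta_nonneg mult_right_mono order.trans)

lemma ctrl_mono: "ctrl s f \<Longrightarrow> s \<le> t \<Longrightarrow> ctrl t f"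
  unfolding ctrl_def using M_pos by (auto intro: is_Lip_mono order.trans)

lemma ctrl_A_Lip:
  assumes "cmod z \<le> 1" "ctrl s f"
  shows "is_Lip \<theta> (A z f) (M * ((1 + \<theta>) / 2 * s))"
proof -
  have "is_Lip \<theta> (A z f) (\<theta> * (M * s) + K * s)"
    by (rule A_Lip) (use assms in \<open>auto simp: ctrl_def\<close>)
  also have "\<theta> * (M * s) + K * s = M * ((1 + \<theta>) / 2 * s)"
    using theta by (simp add: M_def field_simps)
  finally show ?thesis .
qed

lemma ctrl_A:
  assumes "cmod z \<le> 1" "ctrl s f"
  shows "ctrl s (A z f)"
proof -
  have "M * ((1 + \<theta>) / 2 * s) \<le> M * (1 * s)"
    using M_pos theta ctrl_nonneg[OF assms(2)] by (intro mult_left_mono mult_right_mono) auto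
  then have "is_Lip \<theta> (A z f) (M * s)"
    using is_Lip_mono[OF ctrl_A_Lip[OF assms]] by simp
  then show ?thesis
    using assms norm_A_le[OF assms(1)] by (auto simp: ctrl_def A_off)
qed

lemma ctrl_A_pow: "cmod z \<le> 1 \<Longrightarrow> ctrl s f \<Longrightarrow> ctrl s ((A z ^^ j) f)"
  by (induction j) (auto intro: ctrl_A)

lemma Fspace_ctrl:
  assumes "f \<in> Fspace \<theta>"
  obtains s where "ctrl s f"
proof -
  obtain s L where f: "0 \<le> s" "\<And>x. cmod (f x) \<le> s" "is_Lip \<theta> f L"
    using FspaceE[OF assms] by blast
  have "0 \<le> L" using f(3) by (simp add: is_Lip_def)
  have "ctrl (s + L / M) f"
    unfolding ctrl_def
  proof (intro conjI allI ballI impI)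
    show "cmod (f x) \<le> s + L / M" for x
      using f(2)[of x] \<open>0 \<le> L\<close> M_pos by (simp add: add_increasing2)
    show "is_Lip \<theta> f (M * (s + L / M))"
      by (rule is_Lip_mono[OF f(3)]) (use f(1) M_pos in \<open>simp add: distrib_left\<close>)
  qed (use assms in \<open>simp add: Fspace_off\<close>)
  then show ?thesis by (rule that)
qed

lemma ctrl_Fspace: "ctrl s f \<Longrightarrow> f \<in> Fspace \<theta>"
  by (rule FspaceI) (auto simp: ctrl_def)

section \<open>Cancellation between words of different lengths\<close>

primrec e :: "nat \<Rightarrow> omega \<Rightarrow> real" where
  "e 0 x = 1"
| "e (Suc m) x = p 0 x * e m (pre 0 x)"

lemma e_ge: "x \<in> Omega_star \<Longrightarrow> c ^ m \<le> e m x"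
  using c_pos p_ge by (induction m arbitrary: x) (auto intro!: mult_mono simp: p_nonneg)

text \<open>\<open>e m x\<close> is the weight of the word of \<open>m\<close> blocks
  \<open>1\<close> in front of \<open>x\<close>. This word has length \<open>m\<close>, hence the
  phase \<open>z ^ m\<close>; all other words together weigh \<open>1 - e m x\<close> and are
  estimated by \<open>s\<close>.\<close>

lemma A_pow_split:
  assumes "cmod z \<le> 1" "ctrl s f" "x \<in> Omega_star"
  shows "cmod ((A z ^^ m) f x - z ^ m * of_real (e m x) * f ((pre 0 ^^ m) x)) \<le> (1 - e m x) * s"
  using assms(3)
proof (induction m arbitrary: x)
  case (Suc m)
  let ?g = "(A z ^^ m) f" and ?y = "pre 0 x"
  let ?b = "of_real (p 0 x) * z :: complex"
  have "cmod (A z ?g x - (\<Sum>n<1. z ^ Suc n * of_real (p n x) * ?g (pre n x))) \<le> (1 - (\<Sum>n<1. p n x)) * s"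
    by (rule A_split) (use assms ctrl_norm[OF ctrl_A_pow] Suc.prems in auto)
  then have 1: "cmod (A z ?g x - ?b * ?g ?y) \<le> (1 - p 0 x) * s"
    by (simp add: mult_ac)
  have "cmod (?b * (?g ?y - z ^ m * of_real (e m ?y) * f ((pre 0 ^^ m) ?y))) \<le> p 0 x * ((1 - e m ?y) * s)"
    using norm_A_term[of z _ _ 1 0 x, OF assms(1) Suc.IH[of ?y]] Suc.prems by (simp add: mult_ac)
  then have "cmod ((A z ?g x - ?b * ?g ?y) + ?b * (?g ?y - z ^ m * of_real (e m ?y) * f ((pre 0 ^^ m) ?y)))
      \<le> (1 - p 0 x) * s + p 0 x * ((1 - e m ?y) * s)"
    by (intro order.trans[OF norm_triangle_ineq add_mono[OF 1]])
  then show ?case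
    by (simp add: algebra_simps funpow_swap1)
qed simp

lemma dtheta_pre0_pow: "dtheta \<theta> ((pre 0 ^^ m) x) ((pre 0 ^^ m) y) = \<theta> ^ m * dtheta \<theta> x y"
  by (induction m) (auto simp: dtheta_pre)

lemma pre0_pow_in_star: "(pre 0 ^^ m) x \<in> Omega_star \<longleftrightarrow> x \<in> Omega_star"
  by (induction m) auto

text \<open>By the parallelogram law the square of the left-hand side is at most
  \<open>4 - \<epsilon>\<^sup>2\<close>; adding \<open>(\<epsilon>\<^sup>2 / 4)\<^sup>2\<close>
  completes the square.\<close>

lemma norm_one_plus_le:
  assumes "cmod z \<le> 1" "\<epsilon> \<le> dist z 1" "0 \<le> \<epsilon>"
  shows "cmod (1 + z) \<le> 2 - \<epsilon>\<^sup>2 / 4"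
proof -
  have "(cmod (1 + z))\<^sup>2 + (cmod (z - 1))\<^sup>2 = 2 + 2 * (cmod z)\<^sup>2"
    by (simp add: cmod_power2) (simp add: power2_eq_square algebra_simps)
  moreover have "(cmod z)\<^sup>2 \<le> 1" using assms(1) by (simp add: power_le_one)
  moreover have "\<epsilon>\<^sup>2 \<le> (cmod (z - 1))\<^sup>2"
    using assms(2,3) by (intro power_mono) (auto simp: dist_norm)
  ultimately have "(cmod (1 + z))\<^sup>2 \<le> 4 - \<epsilon>\<^sup>2" by linarith
  also have "\<dots> \<le> 4 - \<epsilon>\<^sup>2 + (\<epsilon>\<^sup>2 / 4)\<^sup>2" by simp
  also have "\<dots> = (2 - \<epsilon>\<^sup>2 / 4)\<^sup>2" by (simp add: power2_eq_square algebra_simps)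
  finally have sq: "(cmod (1 + z))\<^sup>2 \<le> (2 - \<epsilon>\<^sup>2 / 4)\<^sup>2" .
  have "\<epsilon> \<le> 2"
    using assms norm_triangle_ineq4[of z 1] by (simp add: dist_norm)
  then have "\<epsilon>\<^sup>2 \<le> 2\<^sup>2" using assms(3) by (intro power_mono)
  then have "0 \<le> 2 - \<epsilon>\<^sup>2 / 4" by simp
  with sq show ?thesis by (rule power2_le_imp_le)
qed

text \<open>Of the words of \<open>m + 1\<close> blocks in front of \<open>x\<close>, compare \<open>1\<dots>11\<close> with \<open>1\<dots>101\<close>. The values of
  \<open>f\<close> there are \<open>M \<theta>\<^sup>m s\<close>-close, but they enter \<open>A\<^sub>z\<^sup>m\<^sup>+\<^sup>1 f\<close> with phases that differ by the factor
  \<open>z\<close>. The total weight being 1, this cancellation pushes the sup norm below \<open>s\<close>.\<close>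

lemma A_pow_contracts_sup:
  assumes \<epsilon>: "0 < \<epsilon>" and m: "M * \<theta> ^ m \<le> \<epsilon>\<^sup>2 / 8"
    and z: "cmod z \<le> 1" "\<epsilon> \<le> dist z 1" and f: "ctrl s f" and x: "x \<in> Omega_star"
  shows "cmod ((A z ^^ Suc m) f x) \<le> (1 - c ^ Suc m * (\<epsilon>\<^sup>2 / 8)) * s"
proof -
  \<comment> \<open>A lower bound, uniform in \<open>x\<close>, for the weights of both words that
    are compared.\<close>
  define q where "q = c ^ Suc m"
  have q0: "0 \<le> q" using c_pos by (simp add: q_def)
  have s0: "0 \<le> s" using ctrl_nonneg[OF f] .
  let ?g = "(A z ^^ m) f"
  define y where "y n = pre n x" for n
  define v where "v n = f ((pre 0 ^^ m) (y n))" for n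
  define a where "a n = p n x * e m (y n)" for n
  have y: "y n \<in> Omega_star" for n using x by (simp add: y_def)
  have qa: "q \<le> a n" if "n \<le> 1" for n
    unfolding q_def a_def power_Suc using that p_ge[OF x that] e_ge[OF y, of m n] c_pos
    by (intro mult_mono) (auto simp: p_nonneg)
  have v: "cmod (v n) \<le> s" for n
    unfolding v_def using ctrl_norm[OF f] y by (simp add: pre0_pow_in_star)
  have "cmod (v 0 - v 1) \<le> (M * s) * dtheta \<theta> ((pre 0 ^^ m) (y 0)) ((pre 0 ^^ m) (y 1))"
    unfolding v_def using f y by (auto simp: ctrl_def is_Lip_def pre0_pow_in_star)
  also have "\<dots> \<le> (M * s) * (\<theta> ^ m * 1)"
    unfolding dtheta_pre0_pow using M_pos s0 theta dtheta_le_1 by (intro mult_left_mono) auto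
  also have "\<dots> = (M * \<theta> ^ m) * s" by simp
  also have "\<dots> \<le> \<epsilon>\<^sup>2 / 8 * s" using m s0 by (rule mult_right_mono)
  finally have v01: "cmod (v 0 - v 1) \<le> \<epsilon>\<^sup>2 / 8 * s" .
  have g: "cmod (z ^ Suc n * of_real (p n x) * (?g (y n) - z ^ m * of_real (e m (y n)) * v n))
      \<le> p n x * ((1 - e m (y n)) * s)" for n
    unfolding v_def by (rule norm_A_term[OF z(1) A_pow_split[OF z(1) f y]])
  let ?t = "\<lambda>n. z ^ Suc n * of_real (p n x) * ?g (y n)"
  have "cmod (A z ?g x - (\<Sum>n<2. z ^ Suc n * of_real (p n x) * ?g (pre n x))) \<le> (1 - (\<Sum>n<2. p n x)) * s"
    by (rule A_split) (use z ctrl_norm[OF ctrl_A_pow[OF z(1) f]] x in auto)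
  then have A: "cmod (A z ?g x - (?t 0 + ?t 1)) \<le> (1 - (p 0 x + p 1 x)) * s"
    by (simp add: numeral_2_eq_2 y_def)
  define r where "r n = z ^ Suc n * of_real (p n x) * (?g (y n) - z ^ m * of_real (e m (y n)) * v n)" for n
  \<comment> \<open>The common weight \<open>q\<close> is taken from both words and the surplus
    \<open>a n - q\<close> is estimated trivially. On the common part, \<open>v 0 + z * v 1\<close>
    is written as \<open>(1 + z) * v 0 - z * (v 0 - v 1)\<close>: the factor \<open>1 + z\<close>
    carries the cancellation, and the second term is small.\<close>
  have "cmod (A z ?g x) = cmod ((A z ?g x - (?t 0 + ?t 1)) + r 0 + r 1 +
      z ^ Suc m * (of_real (a 0 - q) * v 0 + of_real (a 1 - q) * (z * v 1)
        + of_real q * ((1 + z) * v 0 - z * (v 0 - v 1))))"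
    unfolding r_def a_def by (rule arg_cong[where f = cmod]) (simp add: algebra_simps)
  also have "\<dots> \<le> (1 - (p 0 x + p 1 x)) * s + p 0 x * ((1 - e m (y 0)) * s) + p 1 x * ((1 - e m (y 1)) * s)
      + ((a 0 - q) * s + (a 1 - q) * s + q * ((2 - \<epsilon>\<^sup>2 / 4) * s + \<epsilon>\<^sup>2 / 8 * s))"
  proof -
    have "cmod (of_real (a 0 - q) * v 0) \<le> (a 0 - q) * s"
      using qa[of 0] v[of 0] by (simp add: norm_mult mult_left_mono del: of_real_diff)
    moreover have zv: "cmod (z * w) \<le> cmod w" for w
      using z(1) by (simp add: norm_mult mult_left_le_one_le)
    then have "cmod (z * v 1) \<le> s" using v[of 1] order.trans by blast
    then have "cmod (of_real (a 1 - q) * (z * v 1)) \<le> (a 1 - q) * s"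
      using qa[of 1] unfolding norm_mult[of "of_real _"] by (simp add: mult_left_mono del: of_real_diff)
    moreover have "cmod ((1 + z) * v 0) \<le> (2 - \<epsilon>\<^sup>2 / 4) * s"
      unfolding norm_mult using norm_one_plus_le[OF z] \<epsilon> v[of 0] order.trans[OF norm_ge_zero norm_one_plus_le[OF z]]
      by (intro mult_mono) auto
    then have "cmod ((1 + z) * v 0 - z * (v 0 - v 1)) \<le> (2 - \<epsilon>\<^sup>2 / 4) * s + \<epsilon>\<^sup>2 / 8 * s"
      by (intro order.trans[OF norm_triangle_ineq4 add_mono] order.trans[OF zv v01])
    then have "cmod (of_real q * ((1 + z) * v 0 - z * (v 0 - v 1))) \<le> q * ((2 - \<epsilon>\<^sup>2 / 4) * s + \<epsilon>\<^sup>2 / 8 * s)"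
      unfolding norm_mult[of "of_real _"] using q0 by (simp add: mult_left_mono)
    ultimately have "cmod (of_real (a 0 - q) * v 0 + of_real (a 1 - q) * (z * v 1)
        + of_real q * ((1 + z) * v 0 - z * (v 0 - v 1)))
        \<le> (a 0 - q) * s + (a 1 - q) * s + q * ((2 - \<epsilon>\<^sup>2 / 4) * s + \<epsilon>\<^sup>2 / 8 * s)"
      by (intro order.trans[OF norm_triangle_ineq] add_mono)
    then have "cmod (z ^ Suc m * (of_real (a 0 - q) * v 0 + of_real (a 1 - q) * (z * v 1)
        + of_real q * ((1 + z) * v 0 - z * (v 0 - v 1))))
        \<le> 1 * ((a 0 - q) * s + (a 1 - q) * s + q * ((2 - \<epsilon>\<^sup>2 / 4) * s + \<epsilon>\<^sup>2 / 8 * s))"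
      unfolding norm_mult[of "z ^ _"] norm_power using z(1)
      by (intro mult_mono power_le_one) auto
    then show ?thesis
      using A g[of 0] g[of 1] unfolding r_def
      by (intro order.trans[OF norm_triangle_ineq] add_mono) auto
  qed
  also have "\<dots> = (1 - q * (\<epsilon>\<^sup>2 / 8)) * s"
    by (simp add: a_def algebra_simps)
  finally show ?thesis by (simp add: q_def)
qed

lemma A_pow_contracts:
  assumes \<epsilon>: "0 < \<epsilon>"
  obtains k \<rho> where "0 < k" "0 < \<rho>" "\<rho> < 1"
    "\<And>z s f. cmod z \<le> 1 \<Longrightarrow> \<epsilon> \<le> dist z 1 \<Longrightarrow> ctrl s f \<Longrightarrow> ctrl (\<rho> * s) ((A z ^^ k) f)"
proof -
  \<comment> \<open>The phases gain \<open>\<epsilon>\<^sup>2 / 4\<close>; for this \<open>m\<close>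
    the difference of the two values of \<open>f\<close> costs at most half of the gain.\<close>
  obtain m where "\<theta> ^ m < \<epsilon>\<^sup>2 / 8 / M"
    using real_arch_pow_inv[of "\<epsilon>\<^sup>2 / 8 / M" \<theta>] \<epsilon> M_pos theta by auto
  then have m: "M * \<theta> ^ m \<le> \<epsilon>\<^sup>2 / 8" using M_pos by (simp add: field_simps)
  \<comment> \<open>The second entry is the factor for the Lipschitz part; it also keeps
    \<open>\<rho>\<close> positive.\<close>
  define \<rho> where "\<rho> = max (1 - c ^ Suc m * (\<epsilon>\<^sup>2 / 8)) ((1 + \<theta>) / 2)"
  have \<rho>: "0 < \<rho>" "\<rho> < 1"
    using theta c_pos \<epsilon> by (auto simp: \<rho>_def less_max_iff_disj)
  have "ctrl (\<rho> * s) ((A z ^^ Suc m) f)"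
    if z: "cmod z \<le> 1" "\<epsilon> \<le> dist z 1" and f: "ctrl s f" for z s f
    unfolding ctrl_def
  proof (intro conjI allI ballI impI)
    have s: "0 \<le> s" using ctrl_nonneg[OF f] .
    show "cmod ((A z ^^ Suc m) f x) \<le> \<rho> * s" if "x \<in> Omega_star" for x
      by (rule order.trans[OF A_pow_contracts_sup[OF \<epsilon> m z f that] mult_right_mono[OF _ s]])
        (simp add: \<rho>_def)
    have "is_Lip \<theta> (A z ((A z ^^ m) f)) (M * ((1 + \<theta>) / 2 * s))"
      by (intro ctrl_A_Lip ctrl_A_pow z f)
    moreover have "M * ((1 + \<theta>) / 2 * s) \<le> M * (\<rho> * s)"
      using s M_pos by (intro mult_left_mono mult_right_mono) (auto simp: \<rho>_def)
    ultimately show "is_Lip \<theta> ((A z ^^ Suc m) f) (M * (\<rho> * s))"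
      by (auto elim: is_Lip_mono)
  qed (simp add: A_off)
  with \<rho> show ?thesis using that[of "Suc m" \<rho>] by blast
qed

text \<open>The sequence \<open>a\<close> depends on \<open>\<epsilon>\<close> only, so the Neumann
  series converges uniformly away from \<open>z = 1\<close>.\<close>

lemma A_pow_decay:
  assumes \<epsilon>: "0 < \<epsilon>"
  obtains a :: "nat \<Rightarrow> real" where "summable a" "\<And>j. 0 \<le> a j"
    "\<And>z s f j. cmod z \<le> 1 \<Longrightarrow> \<epsilon> \<le> dist z 1 \<Longrightarrow> ctrl s f \<Longrightarrow> ctrl (a j * s) ((A z ^^ j) f)"
proof -
  obtain k \<rho> where k: "0 < k" and \<rho>: "0 < \<rho>" "\<rho> < 1"
    and contr: "\<And>z s f. cmod z \<le> 1 \<Longrightarrow> \<epsilon> \<le> dist z 1 \<Longrightarrow> ctrl s f \<Longrightarrow> ctrl (\<rho> * s) ((A z ^^ k) f)"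
    using A_pow_contracts[OF \<epsilon>] by blast
  define r where "r = root k \<rho>"
  have r: "0 < r" "r < 1" "r ^ k = \<rho>" using k \<rho> by (auto simp: r_def)
  \<comment> \<open>As \<open>r ^ k = \<rho>\<close>, the division by \<open>\<rho>\<close> pays for
    the \<open>j mod k\<close> steps that do not complete a batch of \<open>k\<close>.\<close>
  define a where "a j = r ^ j / \<rho>" for j
  have "ctrl (a j * s) ((A z ^^ j) f)" if z: "cmod z \<le> 1" "\<epsilon> \<le> dist z 1" and f: "ctrl s f" for z s f j
  proof -
    have "ctrl (\<rho> ^ i * s) ((A z ^^ (k * i)) f)" for i
    proof (induction i)
      case (Suc i)
      then show ?case using contr[OF z Suc] by (simp add: funpow_add mult.assoc)
    qed (simp add: f)
    from ctrl_A_pow[OF z(1) this[of "j div k"], of "j mod k"]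
    have "ctrl (\<rho> ^ (j div k) * s) ((A z ^^ (j mod k + k * (j div k))) f)"
      by (simp only: funpow_add comp_def)
    then have "ctrl (\<rho> ^ (j div k) * s) ((A z ^^ j) f)" by simp
    moreover have "\<rho> ^ (j div k) \<le> a j"
    proof -
      have "\<rho> ^ (j div k) * \<rho> = r ^ (k * (j div k) + k)"
        using r(3) by (simp add: power_add power_mult)
      also have "\<dots> \<le> r ^ j"
      proof (rule power_decreasing)
        have "j mod k < k" using k by simp
        then show "j \<le> k * (j div k) + k"
          using mult_div_mod_eq[of k j] by linarith
      qed (use r in auto)
      finally show ?thesis using \<rho> by (simp add: a_def field_simps)
    qed
    ultimately show ?thesis
      using ctrl_mono mult_right_mono[OF _ ctrl_nonneg[OF f]] by blast
  qed
  moreover have "summable a"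
    unfolding a_def using r by (intro summable_divide summable_geometric) auto
  ultimately show ?thesis using that[of a] r \<rho> by (simp add: a_def)
qed

end

section \<open>The resolvent and the renewal equation\<close>

lemma continuous_on_suminf:
  fixes f :: "nat \<Rightarrow> 'a::topological_space \<Rightarrow> 'b::banach"
  assumes "\<And>n. continuous_on S (f n)" "\<And>n x. x \<in> S \<Longrightarrow> norm (f n x) \<le> b n" "summable b"
  shows "continuous_on S (\<lambda>x. \<Sum>n. f n x)"
  by (rule uniform_limit_theorem[OF _ Weierstrass_m_test[OF assms(2,3)]])
    (auto intro!: always_eventually continuous_on_sum assms(1))

text \<open>A Cauchy product whose second factor depends on the index \<open>k\<close> of the first
  one, just as the point from which a renewal restarts depends on the block last placed.\<close>

lemma LIMSEQ_sum_triangle: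
  fixes c :: "nat \<Rightarrow> complex" and b :: "nat \<Rightarrow> nat \<Rightarrow> complex"
  assumes r: "0 \<le> r" "r < 1" and c: "\<And>k. cmod (c k) \<le> r ^ k" and b: "\<And>k j. cmod (b k j) \<le> r ^ j"
  shows "(\<lambda>N. \<Sum>n<N. \<Sum>k\<le>n. c k * b k (n - k)) \<longlonglongrightarrow> (\<Sum>k. c k * (\<Sum>j. b k j))"
proof -
  have sr: "summable (\<lambda>j. r ^ j)" using r by (intro summable_geometric) auto
  have sb: "summable (b k)" for k
    by (rule summable_comparison_test'[OF sr b])
  have tail: "cmod ((\<Sum>j. b k j) - (\<Sum>j<i. b k j)) \<le> r ^ i / (1 - r)" for k i
  proof -
    have "(\<Sum>j. b k j) - (\<Sum>j<i. b k j) = (\<Sum>j. b k (j + i))"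
      using suminf_minus_initial_segment[OF sb] by simp
    also have "cmod \<dots> \<le> (\<Sum>j. r ^ (j + i))"
      by (rule norm_suminf_le) (use b sr in \<open>auto intro: summable_ignore_initial_segment\<close>)
    also have "(\<Sum>j. r ^ (j + i)) = r ^ i / (1 - r)"
      using suminf_mult2[OF sr, of "r ^ i"] suminf_geometric[of r] r by (simp add: power_add)
    finally show ?thesis .
  qed
  have cb: "summable (\<lambda>k. c k * (\<Sum>j. b k j))"
  proof (rule summable_comparison_test'[OF summable_mult2[OF sr, of "1 / (1 - r)"]])
    show "norm (c k * (\<Sum>j. b k j)) \<le> r ^ k * (1 / (1 - r))" for k
      unfolding norm_mult using c[of k] tail[of k 0] r by (intro mult_mono) auto
  qed
  have tri: "(\<Sum>n<N. \<Sum>k\<le>n. c k * b k (n - k)) = (\<Sum>k<N. c k * (\<Sum>j<N - k. b k j))" for N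
  proof -
    have "{(i, j). i + j < N} = Sigma {..<N} (\<lambda>i. {..<N - i})" by auto
    then have "(\<Sum>n<N. \<Sum>k\<le>n. c k * b k (n - k)) = (\<Sum>(k, j)\<in>Sigma {..<N} (\<lambda>i. {..<N - i}). c k * b k j)"
      using sum.triangle_reindex[of "\<lambda>k j. c k * b k j" N] by simp
    then show ?thesis by (simp add: sum.Sigma sum_distrib_left)
  qed
  have "(\<lambda>N. (\<Sum>k<N. c k * (\<Sum>j. b k j)) - (\<Sum>n<N. \<Sum>k\<le>n. c k * b k (n - k))) \<longlonglongrightarrow> 0"
  proof (rule Lim_null_comparison[OF always_eventually])
    have "(\<lambda>n. of_nat n * r ^ n) \<longlonglongrightarrow> 0"
      using powser_times_n_limit_0[of r] r by simp
    then show "(\<lambda>n. of_nat n * r ^ n / (1 - r)) \<longlonglongrightarrow> 0"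
      by (rule tendsto_divide_zero)
    show "\<forall>N. norm ((\<Sum>k<N. c k * (\<Sum>j. b k j)) - (\<Sum>n<N. \<Sum>k\<le>n. c k * b k (n - k)))
        \<le> of_nat N * r ^ N / (1 - r)"
    proof
      fix N
      have "norm ((\<Sum>k<N. c k * (\<Sum>j. b k j)) - (\<Sum>n<N. \<Sum>k\<le>n. c k * b k (n - k)))
          = norm (\<Sum>k<N. c k * ((\<Sum>j. b k j) - (\<Sum>j<N - k. b k j)))"
        unfolding tri by (simp add: sum_subtractf right_diff_distrib)
      \<comment> \<open>Row \<open>k\<close> of the triangle stops after \<open>N - k\<close> terms,
        and its weighted missing tail is at most \<open>r ^ N / (1 - r)\<close> whatever
        \<open>k\<close> is. The \<open>N\<close> rows together still vanish in the limit.\<close>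
      also have "\<dots> \<le> (\<Sum>k<N. r ^ N / (1 - r))"
      proof (rule sum_norm_le)
        fix k assume "k \<in> {..<N}"
        then have N: "r ^ N = r ^ k * r ^ (N - k)" by (simp flip: power_add)
        have "norm (c k * ((\<Sum>j. b k j) - (\<Sum>j<N - k. b k j))) \<le> r ^ k * (r ^ (N - k) / (1 - r))"
          unfolding norm_mult using c[of k] tail[of k "N - k"] r by (intro mult_mono) auto
        then show "norm (c k * ((\<Sum>j. b k j) - (\<Sum>j<N - k. b k j))) \<le> r ^ N / (1 - r)"
          unfolding N by (simp only: times_divide_eq_right)
      qed
      finally show "norm ((\<Sum>k<N. c k * (\<Sum>j. b k j)) - (\<Sum>n<N. \<Sum>k\<le>n. c k * b k (n - k)))
          \<le> of_nat N * r ^ N / (1 - r)" by simp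
    qed
  qed
  then show ?thesis by (rule Lim_transform2[OF summable_LIMSEQ[OF cb]])
qed

context block_chain
begin

lemma A_minus:
  assumes "cmod z \<le> 1" "\<And>x. x \<in> Omega_star \<Longrightarrow> cmod (f x) \<le> s"
    "\<And>x. x \<in> Omega_star \<Longrightarrow> cmod (g x) \<le> t"
  shows "A z (\<lambda>x. f x - g x) x = A z f x - A z g x"
  unfolding A_def right_diff_distrib
  by (intro suminf_diff[symmetric] summable_A) (use assms in auto)

lemma A_pow_off: "f \<in> Fspace \<theta> \<Longrightarrow> x \<notin> Omega_star \<Longrightarrow> (A z ^^ j) f x = 0"
  by (cases j) (auto simp: Fspace_off A_off)

section \<open>The Neumann series of \<open>A z\<close> on the punctured closed disc\<close>

definition G :: "complex \<Rightarrow> (omega \<Rightarrow> complex) \<Rightarrow> omega \<Rightarrow> complex" where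
  "G z f x = (\<Sum>j. (A z ^^ j) f x)"

lemma norm_A_pow_le:
  assumes "\<And>z s f j. cmod z \<le> 1 \<Longrightarrow> \<epsilon> \<le> dist z 1 \<Longrightarrow> ctrl s f \<Longrightarrow> ctrl (a j * s) ((A z ^^ j) f)"
    and "cmod z \<le> 1" "\<epsilon> \<le> dist z 1" "ctrl s f" "\<And>j. 0 \<le> a j"
  shows "cmod ((A z ^^ j) f x) \<le> a j * s"
proof (cases "x \<in> Omega_star")
  case True
  then show ?thesis using assms ctrl_norm by blast
next
  case False
  then show ?thesis
    using A_pow_off[OF ctrl_Fspace[OF assms(4)] False] assms(5)[of j] ctrl_nonneg[OF assms(4)] by simp
qed

lemma G_bounded:
  assumes f: "f \<in> Fspace \<theta>" and \<epsilon>: "0 < \<epsilon>"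
  obtains B where "\<And>z x. cmod z \<le> 1 \<Longrightarrow> \<epsilon> \<le> dist z 1 \<Longrightarrow> cmod (G z f x) \<le> B"
proof -
  obtain s where s: "ctrl s f" using Fspace_ctrl[OF f] .
  obtain a where a: "summable a" "\<And>j. 0 \<le> a j"
    "\<And>z s f j. cmod z \<le> 1 \<Longrightarrow> \<epsilon> \<le> dist z 1 \<Longrightarrow> ctrl s f \<Longrightarrow> ctrl (a j * s) ((A z ^^ j) f)"
    using A_pow_decay[OF \<epsilon>] by blast
  have "cmod (G z f x) \<le> (\<Sum>j. a j * s)" if "cmod z \<le> 1" "\<epsilon> \<le> dist z 1" for z x
    unfolding G_def using norm_A_pow_le[OF a(3) that s a(2)]
    by (intro norm_suminf_le summable_mult2 a) auto
  then show ?thesis by (rule that)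
qed

text \<open>The last claim excludes 1 as an eigenvalue of \<open>A z\<close>: the iterates of a
  fixed function would be constant and yet summable.\<close>

lemma
  assumes z: "cmod z \<le> 1" "z \<noteq> 1" and f: "f \<in> Fspace \<theta>"
  shows G_Fspace: "G z f \<in> Fspace \<theta>"
    and G_resolvent: "G z f x - A z (G z f) x = f x"
    and A_fixpoint: "A z f = f \<Longrightarrow> f = (\<lambda>_. 0)"
proof -
  have z1: "0 < dist z 1" "dist z 1 \<le> dist z 1" using z by auto
  obtain s where s: "ctrl s f" using Fspace_ctrl[OF f] .
  obtain a where a: "summable a" "\<And>j. 0 \<le> a j"
    "\<And>w s f j. cmod w \<le> 1 \<Longrightarrow> dist z 1 \<le> dist w 1 \<Longrightarrow> ctrl s f \<Longrightarrow> ctrl (a j * s) ((A w ^^ j) f)"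
    using A_pow_decay[OF z1(1)] by blast
  have bound: "cmod ((A z ^^ j) f x) \<le> a j * s" for j x
    by (rule norm_A_pow_le[OF a(3) z(1) z1(2) s a(2)])
  have sa: "summable (\<lambda>j. a j * s)" using a(1) by (rule summable_mult2)
  have sA: "summable (\<lambda>j. (A z ^^ j) f x)" for x
    by (rule summable_comparison_test'[OF sa bound])
  define S where "S N x = (\<Sum>j<N. (A z ^^ j) f x)" for N x
  have lim_S: "(\<lambda>N. S N x) \<longlonglongrightarrow> G z f x" for x
    unfolding S_def G_def using summable_LIMSEQ[OF sA] .
  have S_le: "cmod (S N x) \<le> (\<Sum>j. a j * s)" for N x
  proof -
    have "cmod (S N x) \<le> (\<Sum>j<N. a j * s)"
      unfolding S_def by (rule sum_norm_le) (rule bound)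
    also have "\<dots> \<le> (\<Sum>j. a j * s)"
      by (rule sum_le_suminf[OF sa]) (use a(2) ctrl_nonneg[OF s] in auto)
    finally show ?thesis .
  qed
  have G_le: "cmod (G z f x) \<le> (\<Sum>j. a j * s)" for x
    by (rule LIMSEQ_le_const2[OF tendsto_norm[OF lim_S]]) (use S_le in blast)
  have Lip: "is_Lip \<theta> (G z f) (M * (\<Sum>j. a j * s))"
    unfolding is_Lip_def
  proof (intro conjI ballI)
    show "0 \<le> M * (\<Sum>j. a j * s)"
      using M_pos order.trans[OF norm_ge_zero G_le] by simp
    fix x y assume xy: "x \<in> Omega_star" "y \<in> Omega_star"
    have "cmod (\<Sum>j. (A z ^^ j) f x - (A z ^^ j) f y) \<le> (\<Sum>j. a j * s * (M * dtheta \<theta> x y))"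
    proof (rule norm_suminf_le)
      fix j
      have "is_Lip \<theta> ((A z ^^ j) f) (M * (a j * s))"
        using a(3)[OF z(1) z1(2) s] by (simp add: ctrl_def)
      then show "cmod ((A z ^^ j) f x - (A z ^^ j) f y) \<le> a j * s * (M * dtheta \<theta> x y)"
        using xy by (simp add: is_Lip_def mult_ac)
    qed (intro summable_mult2 a)
    also have "(\<Sum>j. (A z ^^ j) f x - (A z ^^ j) f y) = G z f x - G z f y"
      unfolding G_def by (rule suminf_diff[symmetric]) (rule sA)+
    also have "(\<Sum>j. a j * s * (M * dtheta \<theta> x y)) = M * (\<Sum>j. a j * s) * dtheta \<theta> x y"
      using suminf_mult2[OF sa, of "M * dtheta \<theta> x y"] by (simp add: mult_ac)
    finally show "cmod (G z f x - G z f y) \<le> M * (\<Sum>j. a j * s) * dtheta \<theta> x y" .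
  qed
  show "G z f \<in> Fspace \<theta>"
    by (rule FspaceI[OF _ G_le Lip]) (use f in \<open>simp add: G_def A_pow_off\<close>)
  have A_S: "A z (S N) x = S (Suc N) x - f x" for N x
  proof (induction N)
    case 0
    show ?case by (simp add: S_def A_def)
  next
    case (Suc N)
    have "A z (S (Suc N)) x = A z (\<lambda>x. S N x + (A z ^^ N) f x) x"
      by (simp add: S_def[abs_def])
    also have "\<dots> = A z (S N) x + A z ((A z ^^ N) f) x"
      by (rule A_add[OF z(1) S_le bound])
    finally have "A z (S (Suc N)) x = S (Suc N) x + (A z ^^ Suc N) f x - f x" by (simp add: Suc)
    then show ?case by (simp add: S_def[of "Suc (Suc N)"] S_def[of "Suc N" x])
  qed
  have "(\<lambda>N. A z (S N) x) \<longlonglongrightarrow> A z (G z f) x"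
  proof (cases "x \<in> Omega_star")
    case True
    \<comment> \<open>Uniform convergence of the partial sums is what lets \<open>A z\<close>,
      itself an infinite sum, pass to the limit.\<close>
    have tail: "cmod (S N y - G z f y) \<le> (\<Sum>j. a (j + N) * s)" for N y
    proof -
      have "G z f y - S N y = (\<Sum>j. (A z ^^ (j + N)) f y)"
        unfolding G_def S_def using suminf_minus_initial_segment[OF sA] by simp
      also have "cmod \<dots> \<le> (\<Sum>j. a (j + N) * s)"
        by (rule norm_suminf_le[OF bound summable_ignore_initial_segment[OF sa]])
      finally show ?thesis by (simp add: norm_minus_commute)
    qed
    have "(\<lambda>N. A z (S N) x - A z (G z f) x) \<longlonglongrightarrow> 0"
    proof (rule Lim_null_comparison[OF always_eventually])
      show "\<forall>N. norm (A z (S N) x - A z (G z f) x) \<le> (\<Sum>j. a (j + N) * s)"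
        using norm_A_le[OF z(1) tail True] A_minus[OF z(1) S_le G_le] by simp
      show "(\<lambda>N. \<Sum>j. a (j + N) * s) \<longlonglongrightarrow> 0"
        using suminf_exist_split2[OF sa] .
    qed
    then show ?thesis by (simp add: LIM_zero_iff)
  qed (simp add: A_off)
  moreover have "(\<lambda>N. A z (S N) x) \<longlonglongrightarrow> G z f x - f x"
    unfolding A_S by (intro tendsto_intros LIMSEQ_Suc lim_S)
  ultimately show "G z f x - A z (G z f) x = f x"
    using LIMSEQ_unique by fastforce
  show "f = (\<lambda>_. 0)" if "A z f = f"
  proof
    fix x
    have "(A z ^^ j) f = f" for j by (induction j) (simp_all add: that)
    then have "(\<lambda>j. f x) \<longlonglongrightarrow> 0"
      using summable_LIMSEQ_zero[OF sA, of x] by simp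
    then show "f x = 0" by (simp add: LIMSEQ_const_iff)
  qed
qed

lemma continuous_A_pow:
  assumes f: "ctrl s f"
  shows "continuous_on (cball 0 1) (\<lambda>z. (A z ^^ j) f x)"
proof (induction j arbitrary: x)
  case (Suc j)
  show ?case
  proof (cases "x \<in> Omega_star")
    case True
    have "continuous_on (cball 0 1) (\<lambda>z. \<Sum>n. z ^ Suc n * of_real (p n x) * (A z ^^ j) f (pre n x))"
    proof (rule continuous_on_suminf)
      show "summable (\<lambda>n. p n x * s)" by (intro summable_mult2 summable_p)
      show "continuous_on (cball 0 1) (\<lambda>z. z ^ Suc n * of_real (p n x) * (A z ^^ j) f (pre n x))" for n
        by (intro continuous_intros Suc.IH)
      show "norm (z ^ Suc n * of_real (p n x) * (A z ^^ j) f (pre n x)) \<le> p n x * s"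
        if "z \<in> cball 0 1" for z n
        using that True ctrl_norm[OF ctrl_A_pow[OF _ f]] by (intro norm_A_term) auto
    qed
    moreover have "(A z ^^ Suc j) f x = (\<Sum>n. z ^ Suc n * of_real (p n x) * (A z ^^ j) f (pre n x))" for z
      unfolding funpow.simps comp_def by (rule A_def)
    ultimately show ?thesis by (simp only:)
  qed (simp add: A_off)
qed simp

lemma continuous_G:
  assumes f: "f \<in> Fspace \<theta>" and \<epsilon>: "0 < \<epsilon>"
  shows "continuous_on {z. cmod z \<le> 1 \<and> \<epsilon> \<le> dist z 1} (\<lambda>z. G z f x)"
proof -
  obtain s where s: "ctrl s f" using Fspace_ctrl[OF f] .
  obtain a where a: "summable a" "\<And>j. 0 \<le> a j"
    "\<And>z s f j. cmod z \<le> 1 \<Longrightarrow> \<epsilon> \<le> dist z 1 \<Longrightarrow> ctrl s f \<Longrightarrow> ctrl (a j * s) ((A z ^^ j) f)"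
    using A_pow_decay[OF \<epsilon>] by blast
  show ?thesis
    unfolding G_def
  proof (rule continuous_on_suminf)
    show "continuous_on {z. cmod z \<le> 1 \<and> \<epsilon> \<le> dist z 1} (\<lambda>z. (A z ^^ j) f x)" for j
      by (rule continuous_on_subset[OF continuous_A_pow[OF s]]) auto
    show "norm ((A z ^^ j) f x) \<le> a j * s" if "z \<in> {z. cmod z \<le> 1 \<and> \<epsilon> \<le> dist z 1}" for z j
      using that norm_A_pow_le[OF a(3) _ _ s a(2)] by auto
  qed (intro summable_mult2 a)
qed

text \<open>For \<open>g = 1\<close> this is the probability, started at \<open>x\<close>, that some partial sum of the block lengths
  equals \<open>n\<close>.\<close>

fun U :: "nat \<Rightarrow> (omega \<Rightarrow> real) \<Rightarrow> omega \<Rightarrow> real" where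
  "U 0 g x = g x"
| "U (Suc n) g x = (\<Sum>k\<le>n. p k x * U (n - k) g (pre k x))"

lemma U_nonneg: "(\<And>x. 0 \<le> g x) \<Longrightarrow> 0 \<le> U n g x"
  by (induction n g x rule: U.induct) (auto intro!: sum_nonneg simp: p_nonneg)

lemma sum_p_le_1: "(\<Sum>k\<le>n. p k x) \<le> 1"
proof (cases "x \<in> Omega_star")
  case True
  then show ?thesis
    using sum_le_suminf[OF summable_p[of x], of "{..n}"] by (simp add: suminf_p p_nonneg)
qed (simp add: p_off)

lemma U_le_1: "(\<And>x. g x \<le> 1) \<Longrightarrow> U n g x \<le> 1"
proof (induction n g x rule: U.induct)
  case (2 n g x)
  have "(\<Sum>k\<le>n. p k x * U (n - k) g (pre k x)) \<le> (\<Sum>k\<le>n. p k x * 1)"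
    by (intro sum_mono mult_left_mono 2) (auto simp: p_nonneg)
  then show ?case using sum_p_le_1[where n = n and x = x] by simp
qed simp

text \<open>\<^const>\<open>U\<close> splits off the block nearest to \<open>x\<close>; here the farthest one is split off.\<close>

lemma U_Suc_right: "U (Suc n) g x = (\<Sum>k\<le>n. U (n - k) (\<lambda>y. p k y * g (pre k y)) x)"
proof (induction n arbitrary: x rule: less_induct)
  case (less n)
  let ?R = "\<lambda>l y. p l y * g (pre l y)"
  \<comment> \<open>The term \<open>k = n\<close> leaves \<open>U 0\<close>, which the induction
    hypothesis does not reach.\<close>
  have "U (Suc n) g x = p n x * g (pre n x) + (\<Sum>k<n. p k x * U (n - k) g (pre k x))"
    by (simp add: lessThan_Suc_atMost[symmetric])
  also have "(\<Sum>k<n. p k x * U (n - k) g (pre k x)) =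
      (\<Sum>k<n. \<Sum>l<n - k. p k x * U (n - Suc k - l) (?R l) (pre k x))"
  proof (rule sum.cong[OF refl])
    fix k assume k: "k \<in> {..<n}"
    then have "n - k = Suc (n - Suc k)" by auto
    then have "U (n - k) g (pre k x) = (\<Sum>l<n - k. U (n - Suc k - l) (?R l) (pre k x))"
      using less.IH[of "n - Suc k" "pre k x"] k by (simp add: lessThan_Suc_atMost)
    then show "p k x * U (n - k) g (pre k x) = (\<Sum>l<n - k. p k x * U (n - Suc k - l) (?R l) (pre k x))"
      by (simp add: sum_distrib_left)
  qed
  \<comment> \<open>The triangle is summed by columns; each column is then a value of
    \<open>U\<close> by its defining recursion.\<close>
  also have "\<dots> = (\<Sum>l<n. \<Sum>k<n - l. p k x * U (n - Suc k - l) (?R l) (pre k x))"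
    unfolding sum.Sigma[OF finite_lessThan ballI[OF finite_lessThan]]
    by (rule sum.reindex_bij_witness[of _ prod.swap prod.swap]) auto
  also have "\<dots> = (\<Sum>l<n. U (n - l) (?R l) x)"
  proof (rule sum.cong[OF refl])
    fix l assume "l \<in> {..<n}"
    then have "n - l = Suc (n - Suc l)" by auto
    then show "(\<Sum>k<n - l. p k x * U (n - Suc k - l) (?R l) (pre k x)) = U (n - l) (?R l) x"
      by (simp add: lessThan_Suc_atMost diff_commute add.commute)
  qed
  also have "p n x * g (pre n x) + \<dots> = (\<Sum>k\<le>n. U (n - k) (?R k) x)"
    by (simp add: lessThan_Suc_atMost[symmetric])
  finally show ?case .
qed

section \<open>The generating function of the renewal probabilities\<close>

definition one_star :: "omega \<Rightarrow> complex" where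
  "one_star x = (if x \<in> Omega_star then 1 else 0)"

lemma one_star_Fspace: "one_star \<in> Fspace \<theta>"
  using Fspace_cylinder[of 0 "\<lambda>_. 1" 1] by (simp add: one_star_def[abs_def])

text \<open>Every block has length at least 1, so one factor \<open>z\<close> can be extracted.
  Inside the disc this is a sup-norm contraction that asks for no regularity of
  \<open>f\<close>.\<close>

lemma norm_A_le_mult:
  assumes "cmod z \<le> 1" "\<And>x. x \<in> Omega_star \<Longrightarrow> cmod (f x) \<le> s" "x \<in> Omega_star"
  shows "cmod (A z f x) \<le> cmod z * s"
proof -
  have "A z f x = (\<Sum>n. z ^ n * of_real (p n x) * (z * f (pre n x)))"
    by (simp add: A_def mult_ac)
  also have "cmod \<dots> \<le> (\<Sum>n. p n x * (cmod z * s))"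
    using assms by (intro norm_suminf_le norm_A_term summable_mult2 summable_p)
      (auto simp: norm_mult mult_left_mono)
  also have "\<dots> = cmod z * s"
    using suminf_mult2[OF summable_p[of x]] suminf_p[OF assms(3)] by simp
  finally show ?thesis .
qed

text \<open>The recursion of \<open>U\<close> becomes \<open>Y = 1 + A z Y\<close>. Since
  \<open>Y\<close> is known only to be bounded, \<open>A_fixpoint\<close> does not apply to its
  difference \<open>D\<close> from the Neumann series; instead \<open>D = A z D\<close> is iterated
  with the factor \<open>cmod z\<close>.\<close>

lemma renewal_sums:
  assumes z: "cmod z < 1" and x: "x \<in> Omega_star"
  shows "(\<lambda>n. z ^ n * of_real (U n (\<lambda>_. 1) x)) sums G z one_star x"
proof -
  let ?u = "\<lambda>n x. U n (\<lambda>_. 1) x"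
  have u: "0 \<le> ?u n x" "?u n x \<le> 1" for n x
    using U_nonneg U_le_1 by auto
  have z1: "cmod z \<le> 1" "z \<noteq> 1" using z by auto
  define Y where "Y x = (\<Sum>n. z ^ n * complex_of_real (?u n x))" for x
  have sg: "summable (\<lambda>n. cmod z ^ n)" using z by (intro summable_geometric) auto
  have le: "cmod (z ^ n * complex_of_real (?u n x)) \<le> cmod z ^ n" for n x
    using u by (simp add: norm_mult norm_power mult_left_le)
  have sY: "summable (\<lambda>n. z ^ n * complex_of_real (?u n x))" for x
    by (rule summable_comparison_test'[OF sg le])
  have Y_le: "cmod (Y x) \<le> 1 / (1 - cmod z)" for x
    using norm_suminf_le[OF le sg] z by (simp add: Y_def suminf_geometric)
  have Y_eq: "Y x = 1 + A z Y x" for x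
  proof -
    let ?c = "\<lambda>k. z ^ Suc k * complex_of_real (p k x)"
    let ?b = "\<lambda>k j. z ^ j * complex_of_real (?u j (pre k x))"
    \<comment> \<open>Collecting by total length recovers the recursion as the coefficient of
      \<open>z ^ Suc n\<close>; the coefficient at index 0 is the summand 1.\<close>
    have "(\<lambda>N. \<Sum>n<N. \<Sum>k\<le>n. ?c k * ?b k (n - k)) \<longlonglongrightarrow> (\<Sum>k. ?c k * (\<Sum>j. ?b k j))"
    proof (rule LIMSEQ_sum_triangle)
      show "cmod (?c k) \<le> cmod z ^ k" for k
      proof -
        have "p k x \<le> 1"
          using sum_p_le_1[where n = k and x = x] member_le_sum[of k "{..k}" "\<lambda>k. p k x"] by (auto simp: p_nonneg)
        then have "cmod z * p k x \<le> 1" using z1 by (intro mult_le_one) (auto simp: p_nonneg)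
        then show ?thesis
          using mult_left_mono[of "cmod z * p k x" 1 "cmod z ^ k"]
          by (simp add: norm_mult norm_power p_nonneg mult_ac)
      qed
    qed (use z le in auto)
    also have "(\<lambda>N. \<Sum>n<N. \<Sum>k\<le>n. ?c k * ?b k (n - k)) =
        (\<lambda>N. \<Sum>n<N. z ^ Suc n * complex_of_real (?u (Suc n) x))"
    proof (intro ext sum.cong refl)
      fix n
      have "?c k * ?b k (n - k) = z ^ Suc n * complex_of_real (p k x * ?u (n - k) (pre k x))"
        if "k \<le> n" for k
        using that by (simp add: power_add[symmetric] algebra_simps)
      then have "(\<Sum>k\<le>n. ?c k * ?b k (n - k)) =
          (\<Sum>k\<le>n. z ^ Suc n * complex_of_real (p k x * ?u (n - k) (pre k x)))"
        by (intro sum.cong refl) auto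
      then show "(\<Sum>k\<le>n. ?c k * ?b k (n - k)) = z ^ Suc n * complex_of_real (?u (Suc n) x)"
        by (simp add: sum_distrib_left)
    qed
    finally have "(\<lambda>n. z ^ Suc n * complex_of_real (?u (Suc n) x)) sums A z Y x"
      by (simp add: sums_def A_def Y_def)
    then have "(\<lambda>n. z ^ n * complex_of_real (?u n x)) sums (A z Y x + 1)"
      by (subst (asm) sums_Suc_iff) simp
    then show ?thesis by (simp add: Y_def sums_iff)
  qed
  have "0 < dist z 1" using z1 by simp
  then obtain s where
    "\<And>w x. cmod w \<le> 1 \<Longrightarrow> dist z 1 \<le> dist w 1 \<Longrightarrow> cmod (G w one_star x) \<le> s"
    using G_bounded[OF one_star_Fspace] by blast
  then have G_le: "cmod (G z one_star x) \<le> s" for x using z1 by blast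
  define D where "D x = Y x - G z one_star x" for x
  have D_eq: "D x = A z D x" if "x \<in> Omega_star" for x
    using Y_eq[of x] G_resolvent[OF z1 one_star_Fspace, of x] A_minus[OF z1(1) Y_le G_le] that
    by (simp add: D_def[abs_def] one_star_def algebra_simps)
  have "cmod (D x) \<le> cmod z ^ j * (1 / (1 - cmod z) + s)" if "x \<in> Omega_star" for x j
    using that
  proof (induction j arbitrary: x)
    case 0
    show ?case unfolding D_def using norm_triangle_ineq4 add_mono[OF Y_le G_le] order.trans by fastforce
  next
    case (Suc j)
    show ?case
      using norm_A_le_mult[OF z1(1) Suc.IH Suc.prems] D_eq[OF Suc.prems] by (simp add: mult_ac)
  qed
  moreover have "(\<lambda>j. cmod z ^ j * (1 / (1 - cmod z) + s)) \<longlonglongrightarrow> 0"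
    using z by (intro tendsto_mult_left_zero LIMSEQ_power_zero) auto
  ultimately have "cmod (D x) \<le> 0"
    using x by (intro LIMSEQ_le_const) auto
  then have "Y x = G z one_star x" by (simp add: D_def)
  then show ?thesis using sY[of x] by (simp add: Y_def sums_iff)
qed

end

section \<open>Stationary measures\<close>

text \<open>Needed for the Borel sets of \<^typ>\<open>omega\<close> to be the product \<open>\<sigma>\<close>-algebra.\<close>

instance bool :: second_countable_topology
proof
  show "\<exists>B::bool set set. countable B \<and> open = generate_topology B"
    by (intro exI[of _ "range lessThan \<union> range greaterThan"]) (auto simp: open_bool_def)
qed

text \<open>Stationarity is asked on Lipschitz functions, the class on which an eigenfunctional
  acts.\<close>

locale stationary_chain = block_chain \<theta> p K c + prob_space N
  for \<theta> p K c and N :: "omega measure" +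
  assumes sets_N [measurable_cong, simp]: "sets N = sets borel"
    and AE_star: "AE x in N. x \<in> Omega_star"
    and p_measurable [measurable]: "p n \<in> borel_measurable borel"
    and stationary: "f \<in> Fspace \<theta> \<Longrightarrow> (\<integral>x. f x \<partial>N) = (\<integral>x. A 1 f x \<partial>N)"
begin

lemma space_N [simp]: "space N = UNIV"
  using sets_eq_imp_space_eq[OF sets_N] by simp

lemma measurable_N: "f \<in> borel_measurable borel \<Longrightarrow> f \<in> borel_measurable N"
  using measurable_cong_sets[OF sets_N refl] by blast

lemma integrable_N_bounded:
  fixes f :: "omega \<Rightarrow> 'b::{banach, second_countable_topology}"
  assumes "f \<in> borel_measurable borel" "\<And>x. norm (f x) \<le> B"
  shows "integrable N f"
  using assms by (intro integrable_const_bound[of _ B]) (auto intro: measurable_N)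

text \<open>The law of the chain after one step, started from \<^term>\<open>N\<close>.\<close>

definition Q :: "omega measure" where
  "Q = distr (density (count_space UNIV \<Otimes>\<^sub>M N) (\<lambda>(k, x). ennreal (p k x))) borel (\<lambda>(k, x). pre k x)"

lemma nn_integral_Q:
  assumes [measurable]: "F \<in> borel_measurable borel"
  shows "(\<integral>\<^sup>+x. F x \<partial>Q) = (\<Sum>k. \<integral>\<^sup>+x. ennreal (p k x) * F (pre k x) \<partial>N)"
proof -
  have [measurable]: "(\<lambda>(k, x). pre k x) \<in> count_space UNIV \<Otimes>\<^sub>M N \<rightarrow>\<^sub>M borel"
    by (rule measurable_pair_measure_countable1) auto
  have [measurable]: "(\<lambda>(k, x). ennreal (p k x)) \<in> borel_measurable (count_space UNIV \<Otimes>\<^sub>M N)"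
    by (rule measurable_pair_measure_countable1) auto
  have "(\<integral>\<^sup>+x. F x \<partial>Q) = (\<integral>\<^sup>+kx. (case kx of (k, x) \<Rightarrow> ennreal (p k x)) * F (case kx of (k, x) \<Rightarrow> pre k x)
      \<partial>(count_space UNIV \<Otimes>\<^sub>M N))"
    unfolding Q_def by (subst nn_integral_distr) (simp_all add: nn_integral_density)
  also have "\<dots> = (\<integral>\<^sup>+k. \<integral>\<^sup>+x. ennreal (p k x) * F (pre k x) \<partial>N \<partial>count_space UNIV)"
    by (subst nn_integral_fst[symmetric]) simp_all
  finally show ?thesis by (simp add: nn_integral_count_space_nat)
qed

text \<open>Cut-off indicators of cylinders are Lipschitz, so stationarity applies to them, and
  cylinders determine a finite measure. Stationarity thereby extends to all nonnegative Borel
  functions.\<close>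

lemma Q_eq: "Q = N"
proof (rule sym, rule measure_eqI_PiM_infinite[where I = UNIV and M = "\<lambda>_. borel"])
  show "sets N = sets (\<Pi>\<^sub>M i\<in>UNIV. borel)" "sets Q = sets (\<Pi>\<^sub>M i\<in>UNIV. borel)"
    by (simp_all add: Q_def sets_PiM_equal_borel)
  show "finite_measure N" by unfold_locales
  fix B :: "nat \<Rightarrow> bool set" and J :: "nat set"
  assume J: "finite J"
  define C where "C = prod_emb UNIV (\<lambda>_. borel) J (Pi\<^sub>E J B)"
  have C: "x \<in> C \<longleftrightarrow> (\<forall>i\<in>J. x i \<in> B i)" for x
    by (auto simp: C_def prod_emb_def PiE_iff)
  have "C = {x \<in> space borel. \<forall>i\<in>J. x i \<in> B i}" using C by auto
  \<comment> \<open>Membership is decided symbol by symbol, so that only coordinate predicates and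
    constants remain.\<close>
  also have "\<dots> = {x \<in> space borel. \<forall>i\<in>J. if x i then True \<in> B i else False \<in> B i}"
    by (auto split: if_splits) (metis (full_types))+
  also have "\<dots> \<in> sets borel" using J by measurable
  finally have [measurable]: "C \<in> sets borel" .
  obtain n where n: "J \<subseteq> {..<n}" using finite_nat_iff_bounded J by blast
  let ?i = "indicator C :: omega \<Rightarrow> real"
  define b where "b x = (if x \<in> Omega_star then complex_of_real (?i x) else 0)" for x
  have b: "b \<in> Fspace \<theta>"
    unfolding b_def[abs_def]
  proof (rule Fspace_cylinder)
    fix x y :: omega assume "\<And>i. i < n \<Longrightarrow> x i = y i"
    then have "x i = y i" if "i \<in> J" for i using n that by blast
    then have "x \<in> C \<longleftrightarrow> y \<in> C" by (simp add: C)
    then show "complex_of_real (?i x) = complex_of_real (?i y)" by (simp add: indicator_def)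
  qed (auto simp: indicator_def)
  \<comment> \<open>The real form of \<open>A 1 b\<close>, needed because \<open>Q\<close> is
    accessible through nonnegative extended integrals.\<close>
  define a where "a x = (\<Sum>k. p k x * ?i (pre k x))" for x
  have sa: "summable (\<lambda>k. p k x * ?i (pre k x))" for x
    by (rule summable_comparison_test'[OF summable_p[of x]]) (simp add: p_nonneg indicator_def)
  have a0: "0 \<le> a x" for x
    unfolding a_def by (intro suminf_nonneg sa) (simp add: p_nonneg)
  have a1: "a x \<le> 1" for x
  proof (cases "x \<in> Omega_star")
    case True
    have "a x \<le> (\<Sum>k. p k x)"
      unfolding a_def by (intro suminf_le sa summable_p) (simp add: p_nonneg indicator_def)
    then show ?thesis using True by (simp add: suminf_p)
  qed (simp add: a_def p_off)
  have [measurable]: "a \<in> borel_measurable borel" unfolding a_def[abs_def] by measurable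
  have "A 1 b x = complex_of_real (a x)" for x
  proof (cases "x \<in> Omega_star")
    case True
    then show ?thesis
      unfolding A_def a_def suminf_of_real[OF sa] by (simp add: b_def)
  qed (simp add: A_off a_def p_off)
  then have A_b: "A 1 b = (\<lambda>x. complex_of_real (a x))" by blast
  have "(\<integral>x. b x \<partial>N) = (\<integral>x. complex_of_real (?i x) \<partial>N)"
  proof (rule integral_cong_AE)
    show "b \<in> borel_measurable N" by (rule measurable_N[OF Fspace_measurable[OF b]])
    show "AE x in N. b x = complex_of_real (?i x)" using AE_star by (auto simp: b_def)
  qed measurable
  then have "complex_of_real (prob C) = complex_of_real (\<integral>x. a x \<partial>N)"
    using stationary[OF b] by (simp add: A_b)
  then have "prob C = (\<integral>x. a x \<partial>N)" by (simp only: of_real_eq_iff)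
  then have "emeasure N C = (\<integral>\<^sup>+x. ennreal (a x) \<partial>N)"
    using integrable_N_bounded[of a 1] a0 a1
    by (subst nn_integral_eq_integral) (auto simp: emeasure_eq_measure)
  also have "\<dots> = (\<integral>\<^sup>+x. (\<Sum>k. ennreal (p k x) * indicator C (pre k x)) \<partial>N)"
  proof (rule nn_integral_cong)
    fix x
    have eq: "ennreal (p k x) * indicator C (pre k x) = ennreal (p k x * ?i (pre k x))" for k
      by (simp add: indicator_def)
    show "ennreal (a x) = (\<Sum>k. ennreal (p k x) * indicator C (pre k x))"
      unfolding a_def eq by (rule suminf_ennreal2[OF _ sa, symmetric]) (simp add: p_nonneg)
  qed
  also have "\<dots> = (\<integral>\<^sup>+x. indicator C x \<partial>Q)"
    by (subst nn_integral_suminf) (auto simp: nn_integral_Q)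
  also have "\<dots> = emeasure Q C"
    by (rule nn_integral_indicator) (simp add: Q_def)
  finally show "emeasure N (prod_emb UNIV (\<lambda>_. borel) J (Pi\<^sub>E J B)) =
      emeasure Q (prod_emb UNIV (\<lambda>_. borel) J (Pi\<^sub>E J B))"
    by (simp add: C_def)
qed

lemma nn_stationary:
  assumes "F \<in> borel_measurable borel"
  shows "(\<integral>\<^sup>+x. F x \<partial>N) = (\<Sum>k. \<integral>\<^sup>+x. ennreal (p k x) * F (pre k x) \<partial>N)"
  using nn_integral_Q[OF assms] by (simp add: Q_eq)

lemma U_measurable:
  assumes "g \<in> borel_measurable borel"
  shows "U n g \<in> borel_measurable borel"
proof (induction n rule: less_induct)
  case (less n)
  show ?case
  proof (cases n)
    case 0
    then show ?thesis using assms by (simp add: fun_eq_iff[of "U 0 g"] cong: measurable_cong)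
  next
    case (Suc l)
    have "(\<lambda>x. \<Sum>k\<le>l. p k x * U (l - k) g (pre k x)) \<in> borel_measurable borel"
    proof (rule borel_measurable_sum)
      fix k
      have [measurable]: "U (l - k) g \<in> borel_measurable borel" by (rule less.IH) (simp add: Suc)
      show "(\<lambda>x. p k x * U (l - k) g (pre k x)) \<in> borel_measurable borel" by measurable
    qed
    then show ?thesis by (simp add: Suc cong: measurable_cong)
  qed
qed

text \<open>Stationarity peels off the block at the front of \<open>x\<close>. If it ends at
  position \<open>n\<close>, the event has occurred; if it is longer, the event fails; if it ends at
  \<open>k < n\<close>, the question passes to position \<open>n - Suc k\<close> of the rest. The
  weight \<open>g\<close> is general because it accumulates the peeled blocks. A peeled block is the
  farthest one in \<open>U\<close>, which is why \<open>U_Suc_right\<close> reassembles the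
  sum.\<close>

lemma nn_integral_U:
  assumes "g \<in> borel_measurable borel" "\<And>x. 0 \<le> g x"
  shows "(\<integral>\<^sup>+x. ennreal (g x) * indicator {x. x n} x \<partial>N) = (\<integral>\<^sup>+x. ennreal (U (Suc n) g x) \<partial>N)"
  using assms
proof (induction n arbitrary: g rule: less_induct)
  case (less n)
  note [measurable] = less.prems(1)
  let ?R = "\<lambda>k y. p k y * g (pre k y)"
  have R: "?R k \<in> borel_measurable borel" "0 \<le> ?R k x" for k x
    using less.prems(2) by (auto simp: p_nonneg)
  let ?t = "\<lambda>k. \<integral>\<^sup>+x. ennreal (p k x) * (ennreal (g (pre k x)) * indicator {x. x n} (pre k x)) \<partial>N"
  have t: "?t k = (\<integral>\<^sup>+x. ennreal (U (n - k) (?R k) x) \<partial>N)" if "k \<le> n" for k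
  proof (cases "k = n")
    case True
    then show ?thesis
      using less.prems(2) by (simp add: pre_apply p_nonneg ennreal_mult')
  next
    case False
    with that have k: "k < n" by simp
    have "?t k = (\<integral>\<^sup>+x. ennreal (?R k x) * indicator {x. x (n - Suc k)} x \<partial>N)"
      using k less.prems(2)
      by (intro nn_integral_cong) (simp add: pre_apply p_nonneg ennreal_mult' mult.assoc indicator_def)
    also have "\<dots> = (\<integral>\<^sup>+x. ennreal (U (Suc (n - Suc k)) (?R k) x) \<partial>N)"
      by (rule less.IH) (use k R in auto)
    also have "Suc (n - Suc k) = n - k" using k by simp
    finally show ?thesis .
  qed
  have "{x::omega. x n} \<in> sets borel" using measurable_coordinate[of n] by (simp add: pred_def)
  then have "(\<integral>\<^sup>+x. ennreal (g x) * indicator {x. x n} x \<partial>N) = (\<Sum>k. ?t k)"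
    by (intro nn_stationary) measurable
  also have "\<dots> = (\<Sum>k\<le>n. ?t k)"
    by (rule suminf_finite) (auto simp: pre_apply)
  also have "\<dots> = (\<Sum>k\<le>n. \<integral>\<^sup>+x. ennreal (U (n - k) (?R k) x) \<partial>N)"
    by (intro sum.cong refl t) auto
  also have "\<dots> = (\<integral>\<^sup>+x. (\<Sum>k\<le>n. ennreal (U (n - k) (?R k) x)) \<partial>N)"
  proof (rule nn_integral_sum[symmetric])
    fix k
    have "U (n - k) (?R k) \<in> borel_measurable borel" by (rule U_measurable[OF R(1)])
    then show "(\<lambda>x. ennreal (U (n - k) (?R k) x)) \<in> borel_measurable N"
      by measurable
  qed
  also have "\<dots> = (\<integral>\<^sup>+x. ennreal (U (Suc n) g x) \<partial>N)"
    unfolding U_Suc_right using U_nonneg[OF R(2)] by (simp add: sum_ennreal)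
  finally show ?case .
qed

section \<open>The renewal sequence of the stationary chain\<close>

definition u :: "nat \<Rightarrow> real" where
  "u n = (\<integral>x. U n (\<lambda>_. 1) x \<partial>N)"

lemma norm_U_one: "\<bar>U n (\<lambda>_. 1) x\<bar> \<le> 1"
  using U_nonneg[of "\<lambda>_. 1" n x] U_le_1[of "\<lambda>_. 1" n x] by simp

lemma integrable_U_one: "integrable N (U n (\<lambda>_. 1))"
  using norm_U_one U_measurable by (intro integrable_N_bounded[of _ 1]) auto

lemma u_0: "u 0 = 1"
  by (simp add: u_def prob_space[simplified])

lemma u_Suc: "u (Suc n) = prob {x. x n}"
proof -
  have "{x::omega. x n} \<in> sets borel" using measurable_coordinate[of n] by (simp add: pred_def)
  then have "emeasure N {x. x n} = (\<integral>\<^sup>+x. ennreal (U (Suc n) (\<lambda>_. 1) x) \<partial>N)"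
    using nn_integral_U[of "\<lambda>_. 1" n] by simp
  also have "\<dots> = ennreal (u (Suc n))"
    unfolding u_def by (intro nn_integral_eq_integral integrable_U_one AE_I2 U_nonneg) simp
  finally show ?thesis
    unfolding emeasure_eq_measure
    by (subst (asm) ennreal_inj) (auto simp: u_def U_nonneg simp del: U.simps intro!: integral_nonneg)
qed

lemma u_sums:
  assumes z: "cmod z < 1"
  shows "(\<lambda>n. z ^ n * complex_of_real (u n)) sums (\<integral>x. G z one_star x \<partial>N)"
proof -
  let ?f = "\<lambda>n x. z ^ n * complex_of_real (U n (\<lambda>_. 1) x)"
  have sg: "summable (\<lambda>n. cmod z ^ n)" using z by (intro summable_geometric) auto
  have le: "norm (?f n x) \<le> cmod z ^ n" for n x
    using norm_U_one[of n x] by (simp add: norm_mult norm_power mult_left_le)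
  have int: "integrable N (?f n)" for n
    using integrable_U_one by (intro integrable_mult_right integrable_of_real)
  have "(\<lambda>n. \<integral>x. ?f n x \<partial>N) sums (\<integral>x. (\<Sum>n. ?f n x) \<partial>N)"
  proof (rule sums_integral[OF int])
    show "AE x in N. summable (\<lambda>n. norm (?f n x))"
      using le by (intro AE_I2 summable_comparison_test'[OF sg]) simp
    show "summable (\<lambda>n. \<integral>x. norm (?f n x) \<partial>N)"
    proof (rule summable_comparison_test'[OF sg])
      fix n
      have "(\<integral>x. norm (?f n x) \<partial>N) \<le> (\<integral>x. cmod z ^ n \<partial>N)"
        by (intro integral_mono integrable_norm int integrable_const le)
      then show "norm (\<integral>x. norm (?f n x) \<partial>N) \<le> cmod z ^ n"
        by (simp add: prob_space[simplified])
    qed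
  qed
  also have "(\<lambda>n. \<integral>x. ?f n x \<partial>N) = (\<lambda>n. z ^ n * complex_of_real (u n))"
    by (simp add: u_def)
  also have "(\<integral>x. (\<Sum>n. ?f n x) \<partial>N) = (\<integral>x. G z one_star x \<partial>N)"
  proof (rule integral_cong_AE)
    show "(\<lambda>x. \<Sum>n. ?f n x) \<in> borel_measurable N" using int by (intro borel_measurable_suminf) auto
    show "G z one_star \<in> borel_measurable N"
      using z by (intro measurable_N Fspace_measurable G_Fspace one_star_Fspace) auto
    show "AE x in N. (\<Sum>n. ?f n x) = G z one_star x"
      using AE_star renewal_sums[OF z] by (auto simp: sums_iff)
  qed
  finally show ?thesis .
qed

lemma continuous_integral_G:
  assumes f: "f \<in> Fspace \<theta>"
  shows "continuous_on (cball 0 1 - {1}) (\<lambda>z. \<integral>x. G z f x \<partial>N)"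
  unfolding continuous_on_eq_continuous_within
proof
  fix z :: complex assume z: "z \<in> cball 0 1 - {1}"
  \<comment> \<open>Half the distance leaves a neighbourhood of \<open>z\<close> that lies
    \<open>\<epsilon>\<close>-away from 1, where one bound on \<open>G\<close> serves for dominated
    convergence.\<close>
  define \<epsilon> where "\<epsilon> = dist z 1 / 2"
  have \<epsilon>: "0 < \<epsilon>" "\<epsilon> < dist z 1" using z by (auto simp: \<epsilon>_def)
  define T where "T = {z. cmod z \<le> 1 \<and> \<epsilon> \<le> dist z 1}"
  obtain B where B: "\<And>z x. cmod z \<le> 1 \<Longrightarrow> \<epsilon> \<le> dist z 1 \<Longrightarrow> cmod (G z f x) \<le> B"
    using G_bounded[OF f \<epsilon>(1)] by blast
  have meas: "G w f \<in> borel_measurable N" if "w \<in> T" for w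
    using that \<epsilon> f by (intro measurable_N Fspace_measurable G_Fspace) (auto simp: T_def)
  have "continuous_on T (\<lambda>z. \<integral>x. G z f x \<partial>N)"
  proof (rule continuous_on_sequentiallyI)
    fix w w0 assume w: "\<forall>n. w n \<in> T" "w0 \<in> T" "w \<longlonglongrightarrow> w0"
    show "(\<lambda>n. \<integral>x. G (w n) f x \<partial>N) \<longlonglongrightarrow> (\<integral>x. G w0 f x \<partial>N)"
    proof (rule integral_dominated_convergence[where w = "\<lambda>_. B"])
      show "AE x in N. (\<lambda>n. G (w n) f x) \<longlonglongrightarrow> G w0 f x"
        using continuous_on_tendsto_compose[OF continuous_G[OF f \<epsilon>(1)] w(3)] w
        by (auto simp: T_def)
      show "AE x in N. norm (G (w n) f x) \<le> B" for n
        using B w(1) by (auto simp: T_def)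
    qed (use w meas in auto)
  qed
  then have "continuous (at z within T) (\<lambda>z. \<integral>x. G z f x \<partial>N)"
    using z \<epsilon> by (auto simp: continuous_on_eq_continuous_within T_def)
  moreover have "at z within cball 0 1 - {1} = at z within T"
  proof (rule at_within_nhd)
    show "z \<in> ball z \<epsilon>" using \<epsilon> by simp
    have "\<epsilon> \<le> dist w 1" if "dist z w < \<epsilon>" for w
      using dist_triangle[of z 1 w] that by (simp add: \<epsilon>_def)
    then show "(cball 0 1 - {1}) \<inter> ball z \<epsilon> - {z} = T \<inter> ball z \<epsilon> - {z}"
      using \<epsilon> by (auto simp: T_def)
  qed simp
  ultimately show "continuous (at z within cball 0 1 - {1}) (\<lambda>z. \<integral>x. G z f x \<partial>N)" by simp
qed

end

section \<open>The chain of an equilibrium state\<close>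

lemma abs_ln_diff_le:
  fixes a b c :: real
  assumes "0 < c" "c \<le> a" "c \<le> b"
  shows "\<bar>ln a - ln b\<bar> \<le> \<bar>a - b\<bar> / c"
proof -
  have *: "ln a - ln b \<le> \<bar>a - b\<bar> / c" if "c \<le> a" "c \<le> b" for a b
  proof -
    have "ln a - ln b \<le> (a - b) / b" using that assms(1) by (intro ln_diff_le) auto
    also have "\<dots> \<le> \<bar>a - b\<bar> / c" using that assms(1) by (intro frac_le) auto
    finally show ?thesis .
  qed
  show ?thesis using *[of a b] *[of b a] assms by (simp add: abs_le_iff abs_minus_commute)
qed

lemma abs_one_minus_exp_le: "\<bar>1 - exp t\<bar> \<le> \<bar>t\<bar> * exp \<bar>t\<bar>" for t :: real
proof (cases "0 \<le> t")
  case True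
  have "exp t * (1 - t) \<le> exp t * exp (- t)"
    using exp_ge_add_one_self[of "- t"] by (intro mult_left_mono) auto
  then show ?thesis using True by (simp add: exp_minus algebra_simps)
next
  case False
  have "1 - exp t \<le> - t" using exp_ge_add_one_self[of t] by linarith
  also have "- t \<le> - t * exp (- t)" using False by (simp add: mult_le_cancel_left)
  finally show ?thesis using False by simp
qed

section \<open>Block weights of an admissible potential\<close>

locale potential =
  fixes V :: "omega \<Rightarrow> real" and C1 C2 C3 \<theta> :: real
  assumes admissible: "admissible_potential V C1 C2 C3 \<theta>"

sublocale potential \<subseteq> block_metric \<theta>
  using admissible by unfold_locales (auto simp: admissible_potential_def)

context potential
begin

lemma C1_pos: "0 < C1" and C3_pos: "0 < C3"
  and V_le: "V x \<le> 0" and V_ge: "- C1 \<le> V x" and V_continuous: "continuous_on UNIV V"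
  using admissible by (auto simp: admissible_potential_def)

lemma Wpot_pre: "Wpot V (pre n x) = (\<Sum>k\<le>n. V ((shift ^^ k) (pre n x)))"
  by (simp add: Wpot_def lessThan_Suc_atMost)

lemma Wpot_le: "Wpot V x \<le> 0"
  unfolding Wpot_def by (intro sum_nonpos V_le)

lemma Wpot_pre_ge: "- C1 * real (Suc n) \<le> Wpot V (pre n x)"
  unfolding Wpot_pre using sum_mono[of "{..n}" "\<lambda>_. - C1" "\<lambda>k. V ((shift ^^ k) (pre n x))"] V_ge
  by (simp add: algebra_simps)

lemma psi_pre_ge: "exp (- C1 * real (Suc n)) \<le> psi V (pre n x)"
  using Wpot_pre_ge by (simp add: psi_def)

lemma summable_psi: "summable (\<lambda>n. psi V (pre n x))"
proof (rule summable_comparison_test')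
  show "summable (\<lambda>n. exp (SUP x\<in>level (Suc n). Wpot V x))"
    using admissible by (simp add: admissible_potential_def)
  show "norm (psi V (pre n x)) \<le> exp (SUP x\<in>level (Suc n). Wpot V x)" for n
    using Wpot_le by (auto simp: psi_def level_def intro!: cSUP_upper bdd_aboveI2)
qed

text \<open>The common block in front forces the first disagreement to have index at least 1, the
  range in which the variation of the induced potential is controlled. The bound is uniform in
  \<open>n\<close>.\<close>

lemma Wpot_pre_Lip:
  assumes "x \<in> Omega_star" "y \<in> Omega_star"
  shows "\<bar>Wpot V (pre n x) - Wpot V (pre n y)\<bar> \<le> C3 * dtheta \<theta> x y"
proof (cases rule: dtheta_cases[of "pre n x" "pre n y" \<theta>])
  case equal
  have "pre n x = pre n y"
    using coordinate_of_sigma[of "pre n x" "pre n y"] equal(1) assms by auto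
  then show ?thesis using C3_pos dtheta_nonneg by simp
next
  case (differ k)
  have k: "1 \<le> k" using differ(2) by (cases k) auto
  have "ereal \<bar>Wpot V (pre n x) - Wpot V (pre n y)\<bar> \<le> Var k (Wpot V)"
    unfolding Var_def using assms differ(3) pre_in_star by (intro Sup_upper) blast
  also have "\<dots> \<le> ereal (C3 * \<theta> ^ k)"
    using admissible k by (simp add: admissible_potential_def)
  finally have "\<bar>Wpot V (pre n x) - Wpot V (pre n y)\<bar> \<le> C3 * (\<theta> * dtheta \<theta> x y)"
    using differ(4) by (simp add: dtheta_pre)
  also have "\<dots> \<le> C3 * (1 * dtheta \<theta> x y)"
    using C3_pos theta dtheta_nonneg by (intro mult_left_mono mult_right_mono) auto
  finally show ?thesis by simp
qed

lemma V_measurable [measurable]: "V \<in> borel_measurable borel"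
  by (rule borel_measurable_continuous_onI[OF V_continuous])

lemma psi_pre_measurable [measurable]: "(\<lambda>x. psi V (pre n x)) \<in> borel_measurable borel"
  unfolding psi_def Wpot_pre by measurable

lemma prepend_False_pre: "prepend [False] (pre n x) = pre (Suc n) x"
proof
  show "prepend [False] (pre n x) i = pre (Suc n) x i" for i
    by (cases i) (auto simp: prepend_def pre_apply)
qed

lemma psi_pre_Suc:
  "psi V (pre (Suc n) x) = phi V (prepend [False] (pre n x)) * psi V (pre n x)"
proof -
  have *: "(shift ^^ Suc k) (pre (Suc n) x) = (shift ^^ k) (pre n x)" for k
    by (simp add: funpow_shift pre_apply fun_eq_iff del: funpow.simps)
  have "Wpot V (pre (Suc n) x) = V (pre (Suc n) x) + Wpot V (pre n x)"
    unfolding Wpot_pre sum.atMost_Suc_shift * by simp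
  then show ?thesis by (simp add: psi_def phi_def exp_add prepend_False_pre)
qed

text \<open>With \<open>j = 0\<close> and summation over \<open>k\<close>, this turns the density
  \<open>density_e\<close> on points that begin with 1 into the transfer operator.\<close>

lemma L0_pow_pre:
  "of_real (psi V (pre j x)) * (L0_op V ^^ k) f (pre j x) =
    of_real (psi V (pre (j + k) x)) * f (pre (j + k) x)"
proof (induction k arbitrary: j)
  case (Suc k)
  show ?case
    using Suc[of "Suc j"] psi_pre_Suc[of j x] by (simp add: L0_op_def prepend_False_pre mult_ac)
qed simp

end

text \<open>\<open>H\<close> is the eigenfunction and \<open>m\<close> the eigenmeasure at \<open>z = 1\<close>.\<close>

locale equilibrium = potential +
  fixes H :: "omega \<Rightarrow> real" and m :: "omega measure"
  assumes H_Fspace: "(\<lambda>x. complex_of_real (H x)) \<in> Fspace \<theta>"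
    and H_pos: "x \<in> Omega_star \<Longrightarrow> 0 < H x"
    and H_eigen: "transfer_op V 1 (\<lambda>x. complex_of_real (H x)) = (\<lambda>x. complex_of_real (H x))"
    and m_prob: "prob_space m" and sets_m [measurable_cong, simp]: "sets m = sets borel"
    and m_star: "AE x in m. x \<in> Omega_star"
    and m_eigen: "f \<in> Fspace \<theta> \<Longrightarrow> transfer_op V 1 f \<in> Fspace \<theta> \<Longrightarrow>
      (\<integral>x. transfer_op V 1 f x \<partial>m) = (\<integral>x. f x \<partial>m)"
    and H_normalized: "(\<integral>x. complex_of_real (H x) \<partial>m) = 1"
begin

lemma space_m [simp]: "space m = UNIV"
  using sets_eq_imp_space_eq[OF sets_m] by simp

abbreviation (input) h :: "omega \<Rightarrow> complex" where
  "h x \<equiv> complex_of_real (H x)"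

lemma H_off: "x \<notin> Omega_star \<Longrightarrow> H x = 0"
  using Fspace_off[OF H_Fspace] by simp

lemma H_nonneg: "0 \<le> H x"
  using H_pos[of x] H_off[of x] by (cases "x \<in> Omega_star") auto

section \<open>A uniform lower bound for the eigenfunction\<close>

lemma H_sums:
  assumes "x \<in> Omega_star"
  shows "(\<lambda>n. psi V (pre n x) * H (pre n x)) sums H x"
proof -
  obtain B where B: "\<And>x. cmod (h x) \<le> B" using FspaceE[OF H_Fspace] by blast
  have s: "summable (\<lambda>n. psi V (pre n x) * H (pre n x))"
  proof (rule summable_comparison_test'[OF summable_mult2[OF summable_psi[of x], of B]])
    show "norm (psi V (pre n x) * H (pre n x)) \<le> psi V (pre n x) * B" for n
      using B[of "pre n x"] by (simp add: psi_def abs_mult)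
  qed
  have "h x = (\<Sum>n. complex_of_real (psi V (pre n x) * H (pre n x)))"
    using fun_cong[OF H_eigen, of x] assms by (simp add: transfer_op_def)
  also have "\<dots> = of_real (\<Sum>n. psi V (pre n x) * H (pre n x))"
    by (rule suminf_of_real[OF s, symmetric])
  finally have "H x = (\<Sum>n. psi V (pre n x) * H (pre n x))"
    by (simp only: of_real_eq_iff)
  then show ?thesis using s by (simp add: sums_iff)
qed

lemma H_ge_pre:
  assumes "x \<in> Omega_star"
  shows "exp (- C1 * real (Suc n)) * H (pre n x) \<le> H x"
proof -
  have "exp (- C1 * real (Suc n)) * H (pre n x) \<le> psi V (pre n x) * H (pre n x)"
    by (intro mult_right_mono psi_pre_ge H_nonneg)
  also have "\<dots> \<le> H x"
    using sum_le_suminf[OF sums_summable[OF H_sums[OF assms]], of "{n}"] sums_unique[OF H_sums[OF assms]]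
    by (simp add: psi_def H_nonneg)
  finally show ?thesis .
qed

text \<open>\<open>H_ge_pre\<close> is iterated along the first \<open>k\<close> blocks of
  \<open>w\<close>: \<open>y\<close> is that word in front of \<open>x\<close>, and \<open>c\<close>
  is the product of the lower bounds for its block weights.\<close>

lemma H_ge_cylinder:
  assumes "w \<in> Omega_star"
  shows "\<exists>c>0. \<forall>x\<in>Omega_star. \<exists>y\<in>Omega_star. (\<forall>j<k. sigma j y = sigma j w) \<and> c * H y \<le> H x"
  using assms
proof (induction k arbitrary: w)
  case 0
  show ?case by (rule exI[of _ 1]) auto
next
  case (Suc k)
  obtain n w' where w: "w = pre n w'" "w' \<in> Omega_star" using Suc.prems by (rule star_pre_cases)
  obtain c where c: "c > 0"
    "\<And>x. x \<in> Omega_star \<Longrightarrow> \<exists>y\<in>Omega_star. (\<forall>j<k. sigma j y = sigma j w') \<and> c * H y \<le> H x"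
    using Suc.IH[OF w(2)] by blast
  have "\<exists>y\<in>Omega_star. (\<forall>j<Suc k. sigma j y = sigma j w) \<and> c * exp (- C1 * real (Suc n)) * H y \<le> H x"
    if x: "x \<in> Omega_star" for x
  proof -
    obtain y where y: "y \<in> Omega_star" "\<forall>j<k. sigma j y = sigma j w'" "c * H y \<le> H x"
      using c(2)[OF x] by blast
    have "c * (exp (- C1 * real (Suc n)) * H (pre n y)) \<le> c * H y"
      using c(1) H_ge_pre[OF y(1)] by (intro mult_left_mono) auto
    then have "c * exp (- C1 * real (Suc n)) * H (pre n y) \<le> H x"
      using y(3) by (simp only: mult.assoc)
    then show ?thesis
      using y by (intro bexI[of _ "pre n y"]) (auto simp: w less_Suc_eq_0_disj)
  qed
  then show ?case using c(1) by (intro exI[of _ "c * exp (- C1 * real (Suc n))"]) auto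
qed

text \<open>Every cylinder is reached from every point with a weight bounded below, so the positivity of
  \<open>H\<close> at a single point gives a uniform bound.\<close>

lemma H_bounded_below:
  obtains c where "0 < c" "\<And>x. x \<in> Omega_star \<Longrightarrow> c \<le> H x"
proof -
  obtain s L where L: "is_Lip \<theta> h L" using FspaceE[OF H_Fspace] by blast
  define w :: omega where "w = (\<lambda>_. True)"
  have w: "w \<in> Omega_star" by (simp add: w_def Omega_star_def)
  have Hw: "0 < H w" by (rule H_pos[OF w])
  have L0: "0 \<le> L" using L by (simp add: is_Lip_def)
  \<comment> \<open>On the cylinder of this depth around \<open>w\<close>, \<open>H\<close> stays
    above \<open>H w / 2\<close>. The \<open>+ 1\<close> avoids a division by zero when
    \<open>L = 0\<close>.\<close>
  obtain k where k: "\<theta> ^ k < H w / 2 / (L + 1)"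
    using real_arch_pow_inv[of "H w / 2 / (L + 1)" \<theta>] theta Hw L0 by auto
  obtain c where c: "c > 0"
    "\<And>x. x \<in> Omega_star \<Longrightarrow> \<exists>y\<in>Omega_star. (\<forall>j<k. sigma j y = sigma j w) \<and> c * H y \<le> H x"
    using H_ge_cylinder[OF w, of k] by blast
  have "c * (H w / 2) \<le> H x" if x: "x \<in> Omega_star" for x
  proof -
    obtain y where y: "y \<in> Omega_star" "\<forall>j<k. sigma j y = sigma j w" "c * H y \<le> H x"
      using c(2)[OF x] by blast
    have "\<bar>H y - H w\<bar> \<le> L * dtheta \<theta> y w"
      using L y(1) w by (auto simp: is_Lip_def simp flip: of_real_diff)
    also have "\<dots> \<le> (L + 1) * \<theta> ^ k"
      using L0 y(2) dtheta_nonneg by (intro mult_mono dtheta_le_power) auto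
    also have "\<dots> \<le> H w / 2" using k L0 by (simp add: field_simps)
    finally have "H w / 2 \<le> H y" by linarith
    then have "c * (H w / 2) \<le> c * H y" using c(1) by simp
    then show ?thesis using y(3) by linarith
  qed
  then show ?thesis using that[of "c * (H w / 2)"] c(1) Hw by simp
qed

text \<open>The Doob transform of the weights of the transfer operator by its eigenfunction.\<close>

definition p :: "nat \<Rightarrow> omega \<Rightarrow> real" where
  "p n x = psi V (pre n x) * H (pre n x) / H x"

text \<open>The lower bound on \<open>H\<close> makes \<open>ln H\<close> Lipschitz on
  \<open>Omega_star\<close>, so \<open>ln (p n x)\<close> is Lipschitz in \<open>x\<close> with a
  constant independent of \<open>n\<close>. Exponentiation gives the relative bound that
  \<open>block_chain\<close> asks for.\<close>

lemma ex_block_chain: "\<exists>Kc. block_chain \<theta> p (fst Kc) (snd Kc)"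
proof -
  obtain c where c: "0 < c" "\<And>x. x \<in> Omega_star \<Longrightarrow> c \<le> H x" using H_bounded_below by blast
  obtain B L where B: "\<And>x. cmod (h x) \<le> B" and L: "is_Lip \<theta> h L" using FspaceE[OF H_Fspace] by blast
  have HB: "H x \<le> B" for x using B[of x] by simp
  have L0: "0 \<le> L" using L by (simp add: is_Lip_def)
  have B0: "0 < B" using c(2)[of "\<lambda>_. True"] HB[of "\<lambda>_. True"] c(1) by (simp add: Omega_star_def)
  \<comment> \<open>One summand for the induced potential, one for \<open>H\<close> in the numerator
    of \<open>p\<close> and one for \<open>H\<close> in its denominator.\<close>
  define K0 where "K0 = C3 + L / c + L / c"
  have "0 \<le> L / c" using L0 c(1) by simp
  then have K0: "0 < K0" using C3_pos unfolding K0_def by linarith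
  have ln_H: "\<bar>ln (H x) - ln (H y)\<bar> \<le> L / c * dtheta \<theta> x y" if "x \<in> Omega_star" "y \<in> Omega_star" for x y
  proof -
    have "\<bar>ln (H x) - ln (H y)\<bar> \<le> \<bar>H x - H y\<bar> / c"
      using c that by (intro abs_ln_diff_le) auto
    also have "\<bar>H x - H y\<bar> \<le> L * dtheta \<theta> x y"
      using L that by (auto simp: is_Lip_def simp flip: of_real_diff)
    finally show ?thesis using c(1) by (simp add: divide_right_mono)
  qed
  \<comment> \<open>\<open>K0 * exp K0\<close> comes from \<open>\<bar>1 - exp t\<bar>\<close> with
    \<open>\<bar>t\<bar> \<le> K0 * dtheta \<theta> x y \<le> K0\<close>. In the other constant,
    \<open>- C1 * 2\<close> bounds the induced potential on blocks of length at most 2, and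
    \<open>c / B\<close> bounds the quotient of two values of \<open>H\<close>.\<close>
  have "block_chain \<theta> p (K0 * exp K0) (exp (- C1 * 2) * c / B)"
  proof
    show "0 < K0 * exp K0" using K0 by simp
    show "0 < exp (- C1 * 2) * c / B" using c B0 by simp
    show "0 \<le> p n x" for n x by (simp add: p_def psi_def H_nonneg)
    show "p n x = 0" if "x \<notin> Omega_star" for n x using that by (simp add: p_def H_off)
    show "(\<lambda>n. p n x) sums 1" if "x \<in> Omega_star" for x
      using sums_divide[OF H_sums[OF that], of "H x"] H_pos[OF that] by (simp add: p_def)
    show "exp (- C1 * 2) * c / B \<le> p n x" if x: "x \<in> Omega_star" and n: "n \<le> 1" for n x
    proof -
      have "exp (- C1 * 2) \<le> exp (- C1 * real (Suc n))" using C1_pos n by simp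
      also have "\<dots> \<le> psi V (pre n x)" by (rule psi_pre_ge)
      finally have "exp (- C1 * 2) * c \<le> psi V (pre n x) * H (pre n x)"
        using c x by (intro mult_mono) (auto simp: psi_def)
      then show ?thesis
        unfolding p_def using HB[of x] H_pos[OF x] c(1) by (intro frac_le) (auto simp: psi_def H_nonneg)
    qed
    show "\<bar>p n x - p n y\<bar> \<le> K0 * exp K0 * p n x * dtheta \<theta> x y"
      if xy: "x \<in> Omega_star" "y \<in> Omega_star" for n x y
    proof -
      let ?d = "dtheta \<theta> x y"
      define t where "t = (Wpot V (pre n y) - Wpot V (pre n x)) + (ln (H (pre n y)) - ln (H (pre n x)))
        - (ln (H y) - ln (H x))"
      have "\<bar>ln (H (pre n x)) - ln (H (pre n y))\<bar> \<le> L / c * (1 * ?d)"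
        using ln_H[of "pre n x" "pre n y"] xy theta L0 c(1) dtheta_nonneg
          mult_left_mono[OF mult_right_mono[of \<theta> 1 ?d], of "L / c"]
        by (simp add: dtheta_pre)
      then have t: "\<bar>t\<bar> \<le> K0 * ?d"
        using Wpot_pre_Lip[OF xy, of n] ln_H[OF xy] unfolding t_def K0_def distrib_right by linarith
      also have "\<dots> \<le> K0" using K0 dtheta_le_1 by (simp add: mult_left_le)
      finally have "exp \<bar>t\<bar> \<le> exp K0" by simp
      have "p n y = p n x * exp t"
        using H_pos[OF xy(1)] H_pos[OF xy(2)] H_pos[of "pre n x"] H_pos[of "pre n y"] xy
        by (simp add: t_def p_def psi_def exp_add exp_diff)
      then have "p n x - p n y = p n x * (1 - exp t)" by (simp add: right_diff_distrib)
      then have "\<bar>p n x - p n y\<bar> = p n x * \<bar>1 - exp t\<bar>"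
        by (simp add: abs_mult) (simp add: p_def psi_def H_nonneg)
      also have "\<dots> \<le> p n x * (\<bar>t\<bar> * exp \<bar>t\<bar>)"
        by (intro mult_left_mono abs_one_minus_exp_le) (simp add: p_def psi_def H_nonneg)
      also have "\<dots> \<le> p n x * ((K0 * ?d) * exp K0)"
        using t \<open>exp \<bar>t\<bar> \<le> exp K0\<close> K0 dtheta_nonneg
        by (intro mult_left_mono mult_mono) (auto simp: p_def psi_def H_nonneg)
      finally show ?thesis by (simp add: mult_ac)
    qed
  qed
  then show ?thesis by (intro exI[of _ "(K0 * exp K0, exp (- C1 * 2) * c / B)"]) simp
qed

text \<open>Fixed by choice, so that the chain can be attached to constants of which only the
  existence matters.\<close>

definition Kc :: "real \<times> real" where
  "Kc = (SOME Kc. block_chain \<theta> p (fst Kc) (snd Kc))"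

definition N :: "omega measure" where
  "N = density m (\<lambda>x. ennreal (H x))"

end

sublocale equilibrium \<subseteq> block_chain \<theta> p "fst Kc" "snd Kc"
  unfolding Kc_def by (rule someI_ex[OF ex_block_chain])

context equilibrium
begin

lemma H_measurable [measurable]: "H \<in> borel_measurable borel"
  using measurable_compose[OF Fspace_measurable[OF H_Fspace] borel_measurable_Re] by simp

section \<open>Conjugation by the eigenfunction\<close>

lemma inverse_H_Fspace: "(\<lambda>x. inverse (h x)) \<in> Fspace \<theta>"
proof -
  obtain c where c: "0 < c" "\<And>x. x \<in> Omega_star \<Longrightarrow> c \<le> H x" using H_bounded_below by blast
  obtain B L where L: "is_Lip \<theta> h L" using FspaceE[OF H_Fspace] by blast
  show ?thesis
  proof (rule FspaceI)
    show "inverse (h x) = 0" if "x \<notin> Omega_star" for x using that by (simp add: H_off)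
    show "cmod (inverse (h x)) \<le> inverse c" if "x \<in> Omega_star" for x
      using c(1) c(2)[OF that] H_pos[OF that] by (simp add: norm_inverse le_imp_inverse_le)
    have "cmod (inverse (h x) - inverse (h y)) \<le> (L / (c * c)) * dtheta \<theta> x y"
      if xy: "x \<in> Omega_star" "y \<in> Omega_star" for x y
    proof -
      have "inverse (h x) - inverse (h y) = (h y - h x) / (h x * h y)"
        using H_pos xy by (simp add: field_simps less_imp_neq[THEN not_sym])
      then have "cmod (inverse (h x) - inverse (h y)) = cmod (h x - h y) / (H x * H y)"
        using H_nonneg by (simp add: norm_divide norm_mult norm_minus_commute)
      also have "\<dots> \<le> (L * dtheta \<theta> x y) / (c * c)"
        using L xy c by (intro frac_le mult_mono) (auto simp: is_Lip_def H_nonneg dtheta_nonneg)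
      finally show ?thesis by simp
    qed
    then show "is_Lip \<theta> (\<lambda>x. inverse (h x)) (L / (c * c))"
      using L c(1) by (simp add: is_Lip_def)
  qed
qed

lemma transfer_conj:
  assumes z: "cmod z \<le> 1" and f: "f \<in> Fspace \<theta>"
  shows "transfer_op V z (\<lambda>x. h x * f x) x = h x * A z f x"
proof (cases "x \<in> Omega_star")
  case True
  obtain s where s: "\<And>x. cmod (f x) \<le> s" using FspaceE[OF f] by blast
  have "h x * A z f x = (\<Sum>n. h x * (z ^ Suc n * complex_of_real (p n x) * f (pre n x)))"
    unfolding A_def by (rule suminf_mult[OF summable_A[where f = f, OF z s], symmetric])
  also have "\<dots> = transfer_op V z (\<lambda>x. h x * f x) x"
    unfolding transfer_op_def using True H_pos[OF True] by (simp add: p_def mult_ac)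
  finally show ?thesis by simp
qed (simp add: transfer_op_def H_off)

text \<open>Division by \<open>H\<close> stays in the Lipschitz space thanks to the lower bound.
  Hence linearity, invariance of the space and absence of fixed points pass from \<open>A z\<close>
  to the transfer operator.\<close>

lemma Fspace_H_cases:
  assumes "f \<in> Fspace \<theta>"
  obtains g where "g \<in> Fspace \<theta>" "f = (\<lambda>x. h x * g x)"
proof (rule that)
  show "(\<lambda>x. inverse (h x) * f x) \<in> Fspace \<theta>"
    by (rule Fspace_mult[OF inverse_H_Fspace assms])
  show "f = (\<lambda>x. h x * (inverse (h x) * f x))"
  proof
    show "f x = h x * (inverse (h x) * f x)" for x
      using H_pos[of x] Fspace_off[OF assms, of x] by (cases "x \<in> Omega_star") auto
  qed
qed

lemma A_Fspace:
  assumes "cmod z \<le> 1" "f \<in> Fspace \<theta>"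
  shows "A z f \<in> Fspace \<theta>"
  using Fspace_ctrl[OF assms(2)] ctrl_A[OF assms(1)] ctrl_Fspace by metis

lemma transfer_add:
  assumes z: "cmod z \<le> 1" and f: "f \<in> Fspace \<theta>" "g \<in> Fspace \<theta>"
  shows "transfer_op V z (\<lambda>x. f x + g x) x = transfer_op V z f x + transfer_op V z g x"
proof -
  obtain f' where f': "f' \<in> Fspace \<theta>" "f = (\<lambda>x. h x * f' x)" using Fspace_H_cases[OF f(1)] .
  obtain g' where g': "g' \<in> Fspace \<theta>" "g = (\<lambda>x. h x * g' x)" using Fspace_H_cases[OF f(2)] .
  obtain s where s: "\<And>x. cmod (f' x) \<le> s" using FspaceE[OF f'(1)] by blast
  obtain t where t: "\<And>x. cmod (g' x) \<le> t" using FspaceE[OF g'(1)] by blast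
  have "(\<lambda>x. f x + g x) = (\<lambda>x. h x * (f' x + g' x))" by (simp add: f' g' distrib_left)
  then show ?thesis
    using transfer_conj[OF z Fspace_add[OF f'(1) g'(1)], of x] transfer_conj[OF z f'(1), of x]
      transfer_conj[OF z g'(1), of x] A_add[OF z s t, where x = x]
    by (simp add: f' g' distrib_left)
qed

lemma transfer_cmult:
  assumes z: "cmod z \<le> 1" and f: "f \<in> Fspace \<theta>"
  shows "transfer_op V z (\<lambda>x. b * f x) x = b * transfer_op V z f x"
proof -
  obtain g where g: "g \<in> Fspace \<theta>" "f = (\<lambda>x. h x * g x)" using Fspace_H_cases[OF f] .
  obtain s where s: "\<And>x. cmod (g x) \<le> s" using FspaceE[OF g(1)] by blast
  have "(\<lambda>x. b * f x) = (\<lambda>x. h x * (b * g x))" by (simp add: g mult_ac)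
  then show ?thesis
    using transfer_conj[OF z Fspace_scale[OF g(1)], of b x] transfer_conj[OF z g(1), of x]
      A_cmult[OF z s, where b = b and x = x] by (simp add: g)
qed

lemma transfer_Fspace:
  assumes z: "cmod z \<le> 1" and f: "f \<in> Fspace \<theta>"
  shows "transfer_op V z f \<in> Fspace \<theta>"
proof -
  obtain g where g: "g \<in> Fspace \<theta>" "f = (\<lambda>x. h x * g x)" using Fspace_H_cases[OF f] .
  then have "transfer_op V z f = (\<lambda>x. h x * A z g x)" using transfer_conj[OF z g(1)] by auto
  then show ?thesis using Fspace_mult[OF H_Fspace A_Fspace[OF z g(1)]] by simp
qed

lemma transfer_fixpoint:
  assumes z: "cmod z \<le> 1" "z \<noteq> 1" and f: "f \<in> Fspace \<theta>" "transfer_op V z f = f"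
  shows "f = (\<lambda>_. 0)"
proof -
  obtain g where g: "g \<in> Fspace \<theta>" "f = (\<lambda>x. h x * g x)" using Fspace_H_cases[OF f(1)] .
  have "A z g x = g x" for x
  proof (cases "x \<in> Omega_star")
    case True
    then show ?thesis
      using transfer_conj[OF z(1) g(1), of x] fun_cong[OF f(2), of x] H_pos[OF True] by (simp add: g(2))
  qed (simp add: A_off Fspace_off[OF g(1)])
  then have "g = (\<lambda>_. 0)" using A_fixpoint[OF z g(1)] by blast
  then show ?thesis by (simp add: g(2))
qed

lemma integral_N:
  assumes "f \<in> Fspace \<theta>"
  shows "(\<integral>x. f x \<partial>N) = (\<integral>x. h x * f x \<partial>m)"
  unfolding N_def using Fspace_measurable[OF assms]
  by (subst integral_density) (auto simp: H_nonneg scaleR_conv_of_real)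

end

sublocale equilibrium \<subseteq> stationary_chain \<theta> p "fst Kc" "snd Kc" N
proof -
  interpret m: prob_space m by (rule m_prob)
  \<comment> \<open>A non-integrable function has integral 0 by default, which the normalization
    rules out.\<close>
  have "integrable m (\<lambda>x. h x)"
    using H_normalized not_integrable_integral_eq by fastforce
  then have "integrable m H" using integrable_Re by fastforce
  moreover have "(\<integral>x. H x \<partial>m) = 1" using H_normalized by simp
  ultimately have "(\<integral>\<^sup>+x. ennreal (H x) \<partial>m) = 1"
    by (simp add: nn_integral_eq_integral H_nonneg)
  moreover have "emeasure N (space N) = (\<integral>\<^sup>+x. ennreal (H x) * indicator (space m) x \<partial>m)"
    unfolding N_def by (subst emeasure_density) auto
  moreover have "\<dots> = (\<integral>\<^sup>+x. ennreal (H x) \<partial>m)"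
    by (rule nn_integral_cong) simp
  ultimately have "emeasure N (space N) = 1" by simp
  then interpret N: prob_space N by (rule prob_spaceI)
  show "stationary_chain \<theta> p (fst Kc) (snd Kc) N"
  proof
    show "sets N = sets borel" by (simp add: N_def)
    show "AE x in N. x \<in> Omega_star"
      unfolding N_def using m_star by (subst AE_density) auto
    show "p n \<in> borel_measurable borel" for n unfolding p_def by measurable
    show "(\<integral>x. f x \<partial>N) = (\<integral>x. A 1 f x \<partial>N)" if f: "f \<in> Fspace \<theta>" for f
    proof -
      have "(\<integral>x. f x \<partial>N) = (\<integral>x. transfer_op V 1 (\<lambda>x. h x * f x) x \<partial>m)"
        using integral_N[OF f] m_eigen[OF Fspace_mult[OF H_Fspace f]]
          transfer_Fspace[OF _ Fspace_mult[OF H_Fspace f], of 1] by simp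
      also have "\<dots> = (\<integral>x. h x * A 1 f x \<partial>m)" using transfer_conj[OF _ f, of 1] by simp
      also have "\<dots> = (\<integral>x. A 1 f x \<partial>N)" by (rule integral_N[symmetric]) (simp add: A_Fspace f)
      finally show ?thesis .
    qed
  qed
qed

section \<open>The correlation generating function\<close>

context equilibrium
begin

section \<open>Correlations as renewal probabilities\<close>

lemma L0_pow_measurable: "(L0_op V ^^ k) h \<in> borel_measurable borel"
proof (induction k)
  case (Suc k)
  note [measurable] = Suc
  have "(\<lambda>x. complex_of_real (phi V (prepend [False] x)) * (L0_op V ^^ k) h (prepend [False] x))
      \<in> borel_measurable borel"
    unfolding phi_def by measurable
  also have "(\<lambda>x. complex_of_real (phi V (prepend [False] x)) * (L0_op V ^^ k) h (prepend [False] x))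
      = (L0_op V ^^ Suc k) h"
    by (rule ext) (simp add: L0_op_def[of _ "(L0_op V ^^ k) h"])
  finally show ?case .
qed simp

lemma density_e_measurable [measurable]: "density_e V h \<in> borel_measurable borel"
proof -
  note [measurable] = L0_pow_measurable
  show ?thesis unfolding density_e_def[abs_def] by measurable
qed

text \<open>On a point \<open>1x\<close> the summands of the density reproduce the eigenvalue
  equation: the left-hand side is the transfer operator applied to \<open>h\<close>, evaluated at
  \<open>x\<close>.\<close>

lemma psi_density_e:
  assumes "x \<in> Omega_star"
  shows "ennreal (psi V (pre 0 x)) * density_e V h (pre 0 x) = ennreal (H x)"
proof -
  have eq: "psi V (pre 0 x) * Re ((L0_op V ^^ k) h (pre 0 x)) = psi V (pre k x) * H (pre k x)" for k
    using arg_cong[OF L0_pow_pre[of 0 x k h], of Re] by simp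
  have "ennreal (psi V (pre 0 x)) * ennreal (Re ((L0_op V ^^ k) h (pre 0 x)))
      = ennreal (psi V (pre k x) * H (pre k x))" for k
    unfolding eq[symmetric] by (rule ennreal_mult'[symmetric]) (simp add: psi_def)
  then have "ennreal (psi V (pre 0 x)) * density_e V h (pre 0 x) = (\<Sum>k. ennreal (psi V (pre k x) * H (pre k x)))"
    unfolding density_e_def by (simp add: ennreal_suminf_cmult[symmetric])
  also have "\<dots> = ennreal (\<Sum>k. psi V (pre k x) * H (pre k x))"
    using H_sums[OF assms] by (intro suminf_ennreal2) (auto simp: psi_def H_nonneg sums_iff)
  finally show ?thesis using H_sums[OF assms] by (simp add: sums_iff)
qed

lemma level_1: "level 1 = {x. x 0}"
proof -
  have "x 0 \<longleftrightarrow> tau x = enat 1" for x :: omega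
  proof
    assume "x 0"
    then have "Inf {enat i |i. x i} \<le> enat 0" by (intro Inf_lower) auto
    then show "tau x = enat 1" by (simp add: tau_def one_enat_def zero_enat_def[symmetric])
  next
    assume t: "tau x = enat 1"
    show "x 0"
    proof (rule ccontr)
      assume "\<not> x 0"
      then have "enat 1 \<le> Inf {enat i |i. x i}"
        by (intro Inf_greatest) (auto simp: Suc_le_eq intro: gr0I)
      then have "1 + enat 1 \<le> tau x" unfolding tau_def by (rule add_left_mono)
      then show False by (simp add: t one_enat_def)
    qed
  qed
  then show ?thesis by (auto simp: level_def)
qed

lemma nn_integral_m:
  assumes [measurable]: "F \<in> borel_measurable borel"
  shows "(\<integral>\<^sup>+x. F x \<partial>m) = (\<integral>\<^sup>+x. ennreal (1 / H x) * F x \<partial>N)"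
proof -
  have "(\<integral>\<^sup>+x. ennreal (1 / H x) * F x \<partial>N) = (\<integral>\<^sup>+x. ennreal (H x) * (ennreal (1 / H x) * F x) \<partial>m)"
    unfolding N_def by (rule nn_integral_density) measurable
  also have "\<dots> = (\<integral>\<^sup>+x. F x \<partial>m)"
  proof (rule nn_integral_cong_AE)
    have "ennreal (H x) * (ennreal (1 / H x) * F x) = F x" if "x \<in> Omega_star" for x
      using H_pos[OF that] by (simp add: mult.assoc[symmetric] ennreal_mult[symmetric])
    then show "AE x in m. ennreal (H x) * (ennreal (1 / H x) * F x) = F x"
      using m_star by auto
  qed
  finally show ?thesis by simp
qed

text \<open>Written over \<open>N\<close>, the density acquires the factor \<open>1 / H\<close>, and
  \<open>F\<close> lives on points that begin with 1. Stationarity therefore leaves only the block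
  \<open>1\<close>, for which the weights cancel to 1 by \<open>psi_density_e\<close>. What remains
  is the \<open>N\<close>-probability that \<open>1x\<close> has a one at position
  \<open>n\<close>.\<close>

lemma ucorr_eq_u: "ucorr V h m n = u n"
proof -
  define T where "T = level 1 \<inter> (shift ^^ n) -` level 1"
  have T: "T = {x. x 0 \<and> x n}"
    by (auto simp: T_def level_1[unfolded One_nat_def] funpow_shift)
  have T_sets [measurable]: "T \<in> sets borel"
  proof -
    have "{x \<in> space borel. (x::omega) 0 \<and> x n} \<in> sets borel" by measurable
    then show ?thesis by (simp add: T)
  qed
  have "{x::omega. pre 0 x n} = {x \<in> space borel. pre 0 x n}" by simp
  also have "\<dots> \<in> sets borel" by measurable
  finally have [measurable]: "{x::omega. pre 0 x n} \<in> sets borel" .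
  define F where "F x = density_e V h x * indicator T x" for x
  have [measurable]: "F \<in> borel_measurable borel" unfolding F_def[abs_def] by measurable
  let ?t = "\<lambda>k. \<integral>\<^sup>+x. ennreal (p k x) * (ennreal (1 / H (pre k x)) * F (pre k x)) \<partial>N"
  have "emeasure (mu V h m) T = (\<integral>\<^sup>+x. F x \<partial>m)"
    unfolding mu_def F_def by (rule emeasure_density) measurable
  also have "\<dots> = (\<integral>\<^sup>+x. ennreal (1 / H x) * F x \<partial>N)"
    by (rule nn_integral_m) measurable
  also have "\<dots> = (\<Sum>k. ?t k)" by (rule nn_stationary) measurable
  also have "\<dots> = (\<Sum>k\<in>{0}. ?t k)"
    by (rule suminf_finite) (auto simp: F_def T pre_apply)
  also have "\<dots> = ?t 0" by simp
  also have "\<dots> = (\<integral>\<^sup>+x. indicator {x. pre 0 x n} x \<partial>N)"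
  proof (rule nn_integral_cong_AE)
    have "ennreal (p 0 x) * (ennreal (1 / H (pre 0 x)) * F (pre 0 x)) = indicator {x. pre 0 x n} x"
      if x: "x \<in> Omega_star" for x
    proof -
      have "p 0 x * (1 / H (pre 0 x)) = (1 / H x) * psi V (pre 0 x)"
        using H_pos[of "pre 0 x"] x by (simp add: p_def)
      then have "ennreal (p 0 x) * ennreal (1 / H (pre 0 x)) = ennreal (1 / H x) * ennreal (psi V (pre 0 x))"
        using H_nonneg p_nonneg by (simp add: ennreal_mult[symmetric] psi_def)
      then have "ennreal (p 0 x) * (ennreal (1 / H (pre 0 x)) * F (pre 0 x)) =
          ennreal (1 / H x) * (ennreal (psi V (pre 0 x)) * density_e V h (pre 0 x)) * indicator T (pre 0 x)"
        by (simp add: F_def mult.assoc[symmetric])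
      also have "\<dots> = indicator T (pre 0 x)"
        using psi_density_e[OF x] H_pos[OF x] by (simp add: ennreal_mult[symmetric])
      also have "\<dots> = indicator {x. pre 0 x n} x"
        by (simp add: T pre_apply indicator_def)
      finally show ?thesis .
    qed
    then show "AE x in N. ennreal (p 0 x) * (ennreal (1 / H (pre 0 x)) * F (pre 0 x)) = indicator {x. pre 0 x n} x"
      using AE_star by auto
  qed
  also have "\<dots> = emeasure N {x. pre 0 x n}" by simp
  finally have "ucorr V h m n = measure N {x. pre 0 x n}"
    by (simp add: ucorr_def measure_def T_def)
  also have "\<dots> = u n"
  \<comment> \<open>For \<open>n = 0\<close> the prepended one itself is read; otherwise position
    \<open>n\<close> of \<open>1x\<close> is position \<open>n - 1\<close> of
    \<open>x\<close>.\<close>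
  proof (cases n)
    case 0
    then show ?thesis using prob_space by (simp add: pre_apply u_0)
  next
    case (Suc k)
    then show ?thesis by (simp add: pre_apply u_Suc)
  qed
  finally show ?thesis .
qed

text \<open>Defined through the Neumann series because convergence of the power series on the circle
  is not claimed.\<close>

definition S :: "complex \<Rightarrow> complex" where
  "S z = (\<integral>x. G z one_star x \<partial>N)"

lemma continuous_S: "continuous_on (cball 0 1 - {1}) S"
  using continuous_integral_G[OF one_star_Fspace] by (simp add: S_def[abs_def])

lemma Sgen_sums: "cmod z < 1 \<Longrightarrow> (\<lambda>n. z ^ n * complex_of_real (ucorr V h m n)) sums S z"
  using u_sums by (simp add: ucorr_eq_u S_def)

lemma Sgen_holomorphic: "Sgen V h m holomorphic_on ball 0 1"
  unfolding holomorphic_on_open[OF open_ball]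
proof
  fix z :: complex assume "z \<in> ball 0 1"
  then have "cmod z < 1" by simp
  then have "((\<lambda>z. \<Sum>n. complex_of_real (ucorr V h m n) * z ^ n) has_field_derivative
      (\<Sum>n. diffs (\<lambda>n. complex_of_real (ucorr V h m n)) n * z ^ n)) (at z)"
    by (intro termdiffs_strong'[where K = 1]) (use Sgen_sums in \<open>auto simp: sums_iff mult.commute\<close>)
  then show "\<exists>f'. (Sgen V h m has_field_derivative f') (at z)"
    unfolding Sgen_def[abs_def] mult.commute[of "_ ^ _"] by blast
qed

section \<open>Splitting off the spectral projection\<close>

lemma S_resolvent:
  assumes z: "cmod z \<le> 1" "z \<noteq> 1"
  obtains g where "g \<in> Fspace \<theta>" "transfer_op V z g = (\<lambda>x. g x - h x)" "S z = (\<integral>x. g x \<partial>m)"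
proof (rule that)
  have G: "G z one_star \<in> Fspace \<theta>" by (rule G_Fspace[OF z one_star_Fspace])
  show "(\<lambda>x. h x * G z one_star x) \<in> Fspace \<theta>" by (rule Fspace_mult[OF H_Fspace G])
  show "S z = (\<integral>x. h x * G z one_star x \<partial>m)" unfolding S_def by (rule integral_N[OF G])
  have "h x * A z (G z one_star) x = h x * G z one_star x - h x" for x
    using arg_cong[OF G_resolvent[OF z one_star_Fspace, of x], of "\<lambda>w. h x * w"]
    by (cases "x \<in> Omega_star") (auto simp: H_off one_star_def algebra_simps)
  then show "transfer_op V z (\<lambda>x. h x * G z one_star x) = (\<lambda>x. h x * G z one_star x - h x)"
    using transfer_conj[OF z(1) G] by auto
qed

text \<open>On the kernel of \<open>nz\<close> the operators \<open>1 - M\<close> and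
  \<open>1 - N\<close> coincide, while on \<open>hz\<close> they act as multiplication by
  \<open>1 - l\<close> and by 1. A solution for the former is thus corrected along \<open>hz\<close>
  into one for the latter; exhibiting this preimage of \<open>h\<close> and proving injectivity
  identifies the value of the inverse.\<close>

lemma S_decomposition:
  assumes z: "cmod z \<le> 1" "z \<noteq> 1" and trip: "eigen_triple V \<theta> z l hz nz"
    and nu: "\<And>f. f \<in> Fspace \<theta> \<Longrightarrow> nu f = (\<integral>x. f x \<partial>m)"
  shows "l \<noteq> 1"
    and "S z = nu (proj_op nz hz h) * inverse (1 - l)
      + nu (inv_one_minus \<theta> (N_op V z l hz nz) h) - nu (proj_op nz hz h)"
proof -
  have hz: "hz \<in> Fspace \<theta>" "transfer_op V z hz = (\<lambda>x. l * hz x)" "nz hz = 1"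
    and nz_dual: "nz \<in> Fdual \<theta>" and nz_eigen: "\<And>f. f \<in> Fspace \<theta> \<Longrightarrow> nz (transfer_op V z f) = l * nz f"
    using trip by (auto simp: eigen_triple_def)
  have nz_add: "nz (\<lambda>x. f x + g x) = nz f + nz g" if "f \<in> Fspace \<theta>" "g \<in> Fspace \<theta>" for f g
    using nz_dual that by (simp add: Fdual_def)
  have nz_cmult: "nz (\<lambda>x. b * f x) = b * nz f" if "f \<in> Fspace \<theta>" for b f
    using nz_dual that by (simp add: Fdual_def)
  have integrable: "integrable m f" if f: "f \<in> Fspace \<theta>" for f
  proof -
    interpret m: prob_space m by (rule m_prob)
    obtain s where "\<And>x. cmod (f x) \<le> s" using FspaceE[OF f] by blast
    then show ?thesis
      using Fspace_measurable[OF f] by (intro m.integrable_const_bound[of _ s]) (auto cong: measurable_cong_sets)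
  qed
  show l: "l \<noteq> 1"
  proof
    assume "l = 1"
    then have "hz = (\<lambda>_. 0)" using transfer_fixpoint[OF z hz(1)] hz(2) by simp
    then show False using hz(3) nz_cmult[OF hz(1), of 0] by simp
  qed
  obtain g where g: "g \<in> Fspace \<theta>" "transfer_op V z g = (\<lambda>x. g x - h x)" "S z = (\<integral>x. g x \<partial>m)"
    using S_resolvent[OF z] .
  define c where "c = nz h"
  define k where "k = c / (1 - l)"
  have "nz g = nz (\<lambda>x. transfer_op V z g x + h x)" by (simp add: g(2))
  also have "\<dots> = l * nz g + c"
    by (simp add: nz_add[OF transfer_Fspace[OF z(1) g(1)] H_Fspace] nz_eigen[OF g(1)] c_def)
  finally have nz_g: "nz g = k" using l by (simp add: k_def field_simps)
  \<comment> \<open>\<open>g\<close> has the \<open>hz\<close>-component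
    \<open>k = c / (1 - l)\<close>. Since \<open>N\<close> annihilates \<open>hz\<close>, the
    solution for \<open>1 - N\<close> must have the component \<open>c\<close> instead. The exchange
    produces \<open>- c * nu hz\<close>, the last term of the formula.\<close>
  define f where "f x = g x + (c - k) * hz x" for x
  have f: "f \<in> Fspace \<theta>"
    unfolding f_def[abs_def] by (intro Fspace_add Fspace_scale g(1) hz(1))
  have nz_f: "nz f = c"
    unfolding f_def[abs_def] using nz_add[OF g(1) Fspace_scale[OF hz(1)]] nz_cmult[OF hz(1)]
    by (simp add: nz_g hz(3))
  let ?N = "N_op V z l hz nz"
  have "f x - ?N f x = h x" for x
  proof -
    have M_f: "transfer_op V z f x = g x - h x + (c - k) * (l * hz x)"
      unfolding f_def[abs_def]
      by (simp add: transfer_add[OF z(1) g(1) Fspace_scale[OF hz(1)]] transfer_cmult[OF z(1) hz(1)] g(2) hz(2))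
    have "f x - ?N f x = h x + (c - k * (1 - l)) * hz x"
      unfolding N_op_def nz_f M_f f_def by (simp add: algebra_simps)
    then show ?thesis using l by (simp add: k_def)
  qed
  moreover have "inj_on (\<lambda>f x. f x - ?N f x) (Fspace \<theta>)"
  proof (rule inj_onI)
    fix f1 f2 assume f12: "f1 \<in> Fspace \<theta>" "f2 \<in> Fspace \<theta>" and eq: "(\<lambda>x. f1 x - ?N f1 x) = (\<lambda>x. f2 x - ?N f2 x)"
    define d where "d x = f1 x + - 1 * f2 x" for x
    have d: "d \<in> Fspace \<theta>"
      unfolding d_def[abs_def] by (intro Fspace_add Fspace_scale f12)
    have nz_d: "nz d = nz f1 - nz f2"
      unfolding d_def[abs_def] by (simp only: nz_add[OF f12(1) Fspace_scale[OF f12(2)]] nz_cmult[OF f12(2)]) simp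
    have M_d: "transfer_op V z d x = transfer_op V z f1 x - transfer_op V z f2 x" for x
      unfolding d_def[abs_def]
      by (simp only: transfer_add[OF z(1) f12(1) Fspace_scale[OF f12(2)]] transfer_cmult[OF z(1) f12(2)]) simp
    have M_d': "transfer_op V z d x = d x + (l * nz d) * hz x" for x
      unfolding M_d nz_d d_def using fun_cong[OF eq, of x, unfolded N_op_def] by algebra
    \<comment> \<open>Applying \<open>nz\<close> to the equation for \<open>d\<close> leaves
      \<open>nz d = 0\<close>, which makes \<open>d\<close> a fixed point of the transfer
      operator.\<close>
    have "l * nz d = nz (\<lambda>x. d x + (l * nz d) * hz x)"
      unfolding nz_eigen[OF d, symmetric] by (rule arg_cong[where f = nz]) (simp add: M_d' fun_eq_iff nz_eigen[OF d])
    also have "\<dots> = nz d + l * nz d"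
      by (simp only: nz_add[OF d Fspace_scale[OF hz(1)]] nz_cmult[OF hz(1)] hz(3) mult_1_right)
    finally have "nz d = 0" by simp
    then have "transfer_op V z d = d" using M_d' by auto
    then have "d = (\<lambda>_. 0)" by (rule transfer_fixpoint[OF z d])
    then show "f1 = f2" by (simp add: d_def fun_eq_iff)
  qed
  ultimately have inv: "inv_one_minus \<theta> ?N h = f"
    unfolding inv_one_minus_def using f by (intro inv_into_f_eq) auto
  have "nu f = S z + (c - k) * nu hz"
    unfolding nu[OF f] nu[OF hz(1)] f_def g(3)
    using integrable[OF g(1)] integrable[OF hz(1)] by simp
  moreover have "nu (proj_op nz hz h) = c * nu hz"
    unfolding proj_op_def c_def[symmetric] nu[OF Fspace_scale[OF hz(1)]] nu[OF hz(1)] by simp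
  ultimately show "S z = nu (proj_op nz hz h) * inverse (1 - l) + nu (inv_one_minus \<theta> ?N h) - nu (proj_op nz hz h)"
    by (simp add: inv k_def divide_inverse algebra_simps)
qed

end

theorem proposition6:
  fixes V :: "omega \<Rightarrow> real" and C1 C2 C3 \<theta> :: real
    and J :: "complex set" and lam :: "complex \<Rightarrow> complex"
    and h :: "complex \<Rightarrow> omega \<Rightarrow> complex"
    and \<nu> :: "complex \<Rightarrow> (omega \<Rightarrow> complex) \<Rightarrow> complex"
    and m :: "omega measure"
  assumes "admissible_potential V C1 C2 C3 \<theta>"
    and "spectral_data V \<theta> J lam h \<nu>"
    and "given_by_measure \<theta> (\<nu> 1) m"
  shows "(\<forall>z\<in>ball 0 1. summable (\<lambda>n. z ^ n * complex_of_real (ucorr V (h 1) m n)))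
    \<and> Sgen V (h 1) m holomorphic_on ball 0 1
    \<and> (\<exists>S. continuous_on (cball 0 1 - {1}) S
         \<and> (\<forall>z\<in>ball 0 1. S z = Sgen V (h 1) m z)
         \<and> (\<exists>\<epsilon>>0. \<forall>z\<in>J. z \<noteq> 1 \<and> dist z 1 < \<epsilon> \<longrightarrow>
              lam z \<noteq> 1 \<and>
              S z = \<nu> 1 (proj_op (\<nu> z) (h z) (h 1)) * inverse (1 - lam z)
                    + \<nu> 1 (inv_one_minus \<theta> (N_op V z (lam z) (h z) (\<nu> z)) (h 1))
                    - \<nu> 1 (proj_op (\<nu> z) (h z) (h 1))))"
proof -
  have lead: "leading_triple V \<theta> 1 (lam 1) (h 1) (\<nu> 1)" and lam1: "lam 1 = 1"
    and trip: "\<And>z. z \<in> J \<union> {1} \<Longrightarrow> eigen_triple V \<theta> z (lam z) (h z) (\<nu> z)"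
    and J: "J \<subseteq> cball 0 1"
    using assms(2) by (auto simp: spectral_data_def dest: spec[of _ "1::real"] openin_imp_subset)
  have trip1: "eigen_triple V \<theta> 1 1 (h 1) (\<nu> 1)" using trip[of 1] lam1 by simp
  have nu1: "\<nu> 1 f = (\<integral>x. f x \<partial>m)" if "f \<in> Fspace \<theta>" for f
    using assms(3) that by (simp add: given_by_measure_def)
  interpret potential V C1 C2 C3 \<theta> by unfold_locales (rule assms(1))
  define H where "H x = Re (h 1 x)" for x
  have h1: "h 1 \<in> Fspace \<theta>" using trip1 by (simp add: eigen_triple_def)
  have h1_H: "h 1 = (\<lambda>x. complex_of_real (H x))"
  proof
    fix x
    show "h 1 x = complex_of_real (H x)"
      using lead Fspace_off[OF h1, of x] by (cases "x \<in> Omega_star") (auto simp: leading_triple_def H_def)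
  qed
  interpret equilibrium V C1 C2 C3 \<theta> H m
  proof (intro equilibrium.intro equilibrium_axioms.intro)
    show "potential V C1 C2 C3 \<theta>" by unfold_locales
    show "(\<lambda>x. complex_of_real (H x)) \<in> Fspace \<theta>" using h1 by (simp add: h1_H)
    show "0 < H x" if "x \<in> Omega_star" for x using lead that by (simp add: leading_triple_def H_def)
    show "transfer_op V 1 (\<lambda>x. complex_of_real (H x)) = (\<lambda>x. complex_of_real (H x))"
      using trip1 by (simp add: eigen_triple_def h1_H)
    show "prob_space m" "sets m = sets borel" "AE x in m. x \<in> Omega_star"
      using assms(3) by (auto simp: given_by_measure_def)
    show "(\<integral>x. complex_of_real (H x) \<partial>m) = 1"
      using trip1 nu1[OF h1] by (simp add: eigen_triple_def h1_H)
    show "(\<integral>x. transfer_op V 1 f x \<partial>m) = (\<integral>x. f x \<partial>m)"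
      if "f \<in> Fspace \<theta>" "transfer_op V 1 f \<in> Fspace \<theta>" for f
      using trip1 that nu1[OF that(1)] nu1[OF that(2)] by (simp add: eigen_triple_def)
  qed
  show ?thesis
    unfolding h1_H
  proof (intro conjI exI[of _ S])
    show "\<forall>z\<in>ball 0 1. summable (\<lambda>n. z ^ n * complex_of_real (ucorr V (\<lambda>x. complex_of_real (H x)) m n))"
      using Sgen_sums by (auto simp: sums_iff)
    show "\<forall>z\<in>ball 0 1. S z = Sgen V (\<lambda>x. complex_of_real (H x)) m z"
      using Sgen_sums by (auto simp: sums_iff Sgen_def)
    show "\<exists>\<epsilon>>0. \<forall>z\<in>J. z \<noteq> 1 \<and> dist z 1 < \<epsilon> \<longrightarrow> lam z \<noteq> 1 \<and>
        S z = \<nu> 1 (proj_op (\<nu> z) (h z) (\<lambda>x. complex_of_real (H x))) * inverse (1 - lam z)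
          + \<nu> 1 (inv_one_minus \<theta> (N_op V z (lam z) (h z) (\<nu> z)) (\<lambda>x. complex_of_real (H x)))
          - \<nu> 1 (proj_op (\<nu> z) (h z) (\<lambda>x. complex_of_real (H x)))"
    \<comment> \<open>The splitting holds at every point of \<open>J\<close> other than 1, so any
      positive radius is a witness.\<close>
    proof (intro exI[of _ 1] conjI ballI impI)
      fix z assume z: "z \<in> J" "z \<noteq> 1 \<and> dist z 1 < 1"
      then have "cmod z \<le> 1" "z \<noteq> 1" "eigen_triple V \<theta> z (lam z) (h z) (\<nu> z)"
        using J trip by auto
      from S_decomposition[OF this nu1]
      show "lam z \<noteq> 1"
        and "S z = \<nu> 1 (proj_op (\<nu> z) (h z) (\<lambda>x. complex_of_real (H x))) * inverse (1 - lam z)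
          + \<nu> 1 (inv_one_minus \<theta> (N_op V z (lam z) (h z) (\<nu> z)) (\<lambda>x. complex_of_real (H x)))
          - \<nu> 1 (proj_op (\<nu> z) (h z) (\<lambda>x. complex_of_real (H x)))"
        by auto
    qed simp
  qed (rule continuous_S Sgen_holomorphic)+
qed

end
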